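(* Let $d\ge2$ and let $\mathcal{P}$ be a transitive subgroup of $\mathrm{Sym}(d)$. Let $W_{\mathcal{P}}$ be the iterated wreath product of $\mathcal{P}$ acting on the $d$-regular rooted tree $T$, and $\mathcal{P}'$ the commutator subgroup of $\mathcal{P}$. Then the following properties are all equivalent: (i) $W_{\mathcal{P}}$ is just-infinite; (ii) $W_{\mathcal{P}}$ is topologically finitely generated; (iii) $W_{\mathcal{P}}$ is strongly complete; (iv) $\mathcal{P}=\mathcal{P}'$. In particular, the whole group $\mathrm{Aut}(T)$ of automorphisms of the tree does not have any of the properties of being just-infinite, topologically finitely generated, or strongly complete.
   Context: $T$ is the $d$-regular rooted tree with vertices the finite words over $X=\{1,\dots,d\}$; $\mathrm{Aut}(T)$ is the group of root- and adjacency-preserving bijections of $T$. For $g\in\mathrm{Aut}(T)$ and a vertex $v$, the section $g|_v\in\mathrm{Aut}(T)$ is defined by $g(vw)=g(v)\,g|_v(w)$, and $g|_v^1\in\mathrm{Sym}(d)$ is the permutation induced by $g|_v$ on the first level. $W_{\mathcal{P}}=\{g\in\mathrm{Aut}(T): g|_v^1\in\mathcal{P}\text{ for all vertices } v\}$, a closed subgroup of $\mathrm{Aut}(T)$, where $\mathrm{Aut}(T)$ is profinite with the pointwise stabilizers of the levels as a base of neighborhoods of the identity. An infinite topological group is just-infinite if every non-trivial closed normal subgroup has finite index; it is topologically finitely generated if it has a dense finitely generated subgroup. A profinite group is strongly complete if every subgroup of finite index is open (equivalently, it is isomorphic to its profinite completion). *)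

theory Defs
  imports "HOL-Analysis.Analysis" "HOL-Algebra.Sym_Groups"
begin

subsection \<open>The regular rooted tree and its automorphisms\<close>

text \<open>
  A word \<open>v\<close> is written from the root downwards, so the children of \<open>v\<close> are the words
  \<open>v @ [x]\<close>, and the subtree below \<open>v\<close> consists of the words \<open>v @ w\<close>.
\<close>

definition tree_verts :: "nat \<Rightarrow> nat list set" where
  "tree_verts d = lists {1..d}"

definition tree_adj :: "nat list \<Rightarrow> nat list \<Rightarrow> bool" where
  "tree_adj u v \<longleftrightarrow> (\<exists>x. v = u @ [x]) \<or> (\<exists>x. u = v @ [x])"

text \<open>
  As in \<^const>\<open>sym_group\<close>, the bijections are represented by total functions that are the
  identity outside the vertex set, and the multiplication is composition of functions.
\<close>

definition tree_aut :: "nat \<Rightarrow> (nat list \<Rightarrow> nat list) monoid" where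
  "tree_aut d =
    \<lparr> carrier = {g. g permutes tree_verts d \<and> g [] = [] \<and>
        (\<forall>u\<in>tree_verts d. \<forall>v\<in>tree_verts d. tree_adj (g u) (g v) \<longleftrightarrow> tree_adj u v)},
      mult = (\<circ>), one = id \<rparr>"

definition level_stab :: "nat \<Rightarrow> nat \<Rightarrow> (nat list \<Rightarrow> nat list) set" where
  "level_stab d n = {g \<in> carrier (tree_aut d). \<forall>v\<in>tree_verts d. length v = n \<longrightarrow> g v = v}"

definition tree_aut_topology :: "nat \<Rightarrow> (nat list \<Rightarrow> nat list) topology" where
  "tree_aut_topology d = topology (\<lambda>U. U \<subseteq> carrier (tree_aut d) \<and>
     (\<forall>g\<in>U. \<exists>n. g <#\<^bsub>tree_aut d\<^esub> level_stab d n \<subseteq> U))"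

text \<open>
  The defining equation \<open>g (v @ w) = g v @ tree_section d g v w\<close> is established below
  (\<open>tree_section_append\<close>).
\<close>

definition tree_section ::
    "nat \<Rightarrow> (nat list \<Rightarrow> nat list) \<Rightarrow> nat list \<Rightarrow> nat list \<Rightarrow> nat list" where
  "tree_section d g v = (\<lambda>w. if w \<in> tree_verts d then drop (length (g v)) (g (v @ w)) else w)"

definition first_level_perm :: "nat \<Rightarrow> (nat list \<Rightarrow> nat list) \<Rightarrow> nat \<Rightarrow> nat" where
  "first_level_perm d g = (\<lambda>x. if x \<in> {1..d} then hd (g [x]) else x)"

definition iterated_wreath :: "nat \<Rightarrow> (nat \<Rightarrow> nat) set \<Rightarrow> (nat list \<Rightarrow> nat list) set" where
  "iterated_wreath d P =
    {g \<in> carrier (tree_aut d). \<forall>v\<in>tree_verts d. first_level_perm d (tree_section d g v) \<in> P}"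

definition transitive_perms :: "nat \<Rightarrow> (nat \<Rightarrow> nat) set \<Rightarrow> bool" where
  "transitive_perms d P \<longleftrightarrow> (\<forall>x\<in>{1..d}. \<forall>y\<in>{1..d}. \<exists>p\<in>P. p x = y)"

subsection \<open>Properties of topological groups\<close>

text \<open>
  In the following, \<open>\<tau>\<close> is meant to be a group topology on \<open>G\<close>, with \<open>topspace \<tau> = carrier G\<close>;
  strong completeness is only used for profinite groups.
\<close>

definition just_infinite :: "('a, 'b) monoid_scheme \<Rightarrow> 'a topology \<Rightarrow> bool" where
  "just_infinite G \<tau> \<longleftrightarrow> infinite (carrier G) \<and>
    (\<forall>N. N \<lhd> G \<and> closedin \<tau> N \<and> N \<noteq> {\<one>\<^bsub>G\<^esub>} \<longrightarrow> finite (rcosets\<^bsub>G\<^esub> N))"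

definition topologically_finitely_generated ::
    "('a, 'b) monoid_scheme \<Rightarrow> 'a topology \<Rightarrow> bool" where
  "topologically_finitely_generated G \<tau> \<longleftrightarrow>
    (\<exists>S. finite S \<and> S \<subseteq> carrier G \<and> \<tau> closure_of (generate G S) = topspace \<tau>)"

definition strongly_complete :: "('a, 'b) monoid_scheme \<Rightarrow> 'a topology \<Rightarrow> bool" where
  "strongly_complete G \<tau> \<longleftrightarrow>
    (\<forall>H. subgroup H G \<and> finite (rcosets\<^bsub>G\<^esub> H) \<longrightarrow> openin \<tau> H)"

subsection \<open>The iterated wreath product as a topological group\<close>

abbreviation wreath_group :: "nat \<Rightarrow> (nat \<Rightarrow> nat) set \<Rightarrow> (nat list \<Rightarrow> nat list) monoid" where
  "wreath_group d P \<equiv> (tree_aut d)\<lparr>carrier := iterated_wreath d P\<rparr>"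

abbreviation wreath_topology ::
    "nat \<Rightarrow> (nat \<Rightarrow> nat) set \<Rightarrow> (nat list \<Rightarrow> nat list) topology" where
  "wreath_topology d P \<equiv> subtopology (tree_aut_topology d) (iterated_wreath d P)"

subsection \<open>Basic facts\<close>

lemma tree_aut_simps [simp]:
  "mult (tree_aut d) = (\<circ>)" "one (tree_aut d) = id"
  by (simp_all add: tree_aut_def)

lemma tree_aut_carrier:
  "g \<in> carrier (tree_aut d) \<longleftrightarrow> g permutes tree_verts d \<and> g [] = [] \<and>
     (\<forall>u\<in>tree_verts d. \<forall>v\<in>tree_verts d. tree_adj (g u) (g v) \<longleftrightarrow> tree_adj u v)"
  by (simp add: tree_aut_def)

lemma tree_verts_simps [simp]:
  "[] \<in> tree_verts d" "u @ v \<in> tree_verts d \<longleftrightarrow> u \<in> tree_verts d \<and> v \<in> tree_verts d"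
  "x # v \<in> tree_verts d \<longleftrightarrow> x \<in> {1..d} \<and> v \<in> tree_verts d"
  by (auto simp: tree_verts_def)

lemma tree_aut_inv_closed:
  assumes "g \<in> carrier (tree_aut d)"
  shows "inv_into UNIV g \<in> carrier (tree_aut d)"
proof -
  have p: "g permutes tree_verts d" and r: "g [] = []"
    and a: "\<And>u v. u \<in> tree_verts d \<Longrightarrow> v \<in> tree_verts d \<Longrightarrow> tree_adj (g u) (g v) \<longleftrightarrow> tree_adj u v"
    using assms by (auto simp: tree_aut_carrier)
  have q: "inv_into UNIV g permutes tree_verts d" using p by (rule permutes_inv)
  have "tree_adj (inv_into UNIV g u) (inv_into UNIV g v) \<longleftrightarrow> tree_adj u v"
    if "u \<in> tree_verts d" "v \<in> tree_verts d" for u v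
    using a[of "inv_into UNIV g u" "inv_into UNIV g v"] that permutes_in_image[OF q]
    by (simp add: permutes_inverses[OF p])
  moreover have "inv_into UNIV g [] = []"
    using permutes_inverses(2)[OF p, of "[]"] r by simp
  ultimately show ?thesis using q by (auto simp: tree_aut_carrier)
qed

lemma tree_aut_comp_closed:
  assumes "g \<in> carrier (tree_aut d)" "h \<in> carrier (tree_aut d)"
  shows "g \<circ> h \<in> carrier (tree_aut d)"
  using assms by (auto simp: tree_aut_carrier permutes_compose permutes_in_image)

lemma id_in_tree_aut: "id \<in> carrier (tree_aut d)"
  by (simp add: tree_aut_carrier permutes_id)

lemma group_tree_aut: "group (tree_aut d)"
proof (rule groupI)
  fix g assume g: "g \<in> carrier (tree_aut d)"
  hence "g permutes tree_verts d" by (simp add: tree_aut_carrier)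
  hence "inv_into UNIV g \<circ> g = id" by (rule permutes_inv_o)
  thus "\<exists>h\<in>carrier (tree_aut d). h \<otimes>\<^bsub>tree_aut d\<^esub> g = \<one>\<^bsub>tree_aut d\<^esub>"
    using tree_aut_inv_closed[OF g] by auto
qed (auto simp: tree_aut_comp_closed id_in_tree_aut o_assoc simp del: comp_apply)

lemma tree_aut_child:
  assumes g: "g \<in> carrier (tree_aut d)"
  shows "v @ [x] \<in> tree_verts d \<Longrightarrow> \<exists>y\<in>{1..d}. g (v @ [x]) = g v @ [y]"
proof (induction v arbitrary: x rule: rev_induct)
  have p: "g permutes tree_verts d" and r: "g [] = []" using g by (auto simp: tree_aut_carrier)
  {
    fix v x assume vx: "v @ [x] \<in> tree_verts d"
    have "g (v @ [x]) \<in> tree_verts d" using vx permutes_in_image[OF p] by blast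
    moreover have "tree_adj (g v) (g (v @ [x]))"
    proof -
      have "tree_adj v (v @ [x])" by (auto simp: tree_adj_def)
      thus ?thesis using g vx by (auto simp: tree_aut_carrier)
    qed
    ultimately have "(\<exists>y\<in>{1..d}. g (v @ [x]) = g v @ [y]) \<or> (\<exists>y. g v = g (v @ [x]) @ [y])"
      unfolding tree_adj_def by force
  } note adj = this
  { case Nil thus ?case using adj[of "[]" x] r by auto }
  { case (snoc z u)
    from snoc.prems have "u @ [z] \<in> tree_verts d" by auto
    from snoc.IH[OF this] obtain y where y: "g (u @ [z]) = g u @ [y]" by blast
    have "g ((u @ [z]) @ [x]) \<noteq> g u"
      using permutes_inj[OF p] by (auto dest: injD)
    thus ?case using adj[OF snoc.prems] y by force }
qed

lemma tree_aut_append: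
  assumes g: "g \<in> carrier (tree_aut d)"
  shows "v @ w \<in> tree_verts d \<Longrightarrow> \<exists>u. length u = length w \<and> g (v @ w) = g v @ u"
proof (induction w rule: rev_induct)
  case (snoc x w)
  then obtain u where u: "length u = length w" "g (v @ w) = g v @ u" by auto
  from snoc.prems tree_aut_child[OF g, of "v @ w" x]
  obtain y where "g (v @ w @ [x]) = g (v @ w) @ [y]" by auto
  thus ?case using u by (intro exI[of _ "u @ [y]"]) auto
qed simp

lemma tree_section_append:
  assumes "g \<in> carrier (tree_aut d)" "v \<in> tree_verts d" "w \<in> tree_verts d"
  shows "g (v @ w) = g v @ tree_section d g v w"
  using tree_aut_append[OF assms(1), of v w] assms(2,3) by (auto simp: tree_section_def)

lemma tree_section_closed:
  assumes g: "g \<in> carrier (tree_aut d)" and v: "v \<in> tree_verts d"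
  shows "tree_section d g v \<in> carrier (tree_aut d)"
proof -
  let ?s = "tree_section d g v"
  note app = tree_section_append[OF g v]
  have p: "g permutes tree_verts d" using g by (simp add: tree_aut_carrier)
  have len: "length (g u) = length u" if "u \<in> tree_verts d" for u
    using tree_aut_append[OF g, of "[]" u] that g by (auto simp: tree_aut_carrier)
  have mem: "?s w \<in> tree_verts d" if "w \<in> tree_verts d" for w
    using app[OF that] permutes_in_image[OF p, of "v @ w"] v that by simp
  have "inj_on ?s (tree_verts d)"
    by (rule inj_onI) (metis app permutes_inj[OF p] injD same_append_eq)
  moreover have "?s ` tree_verts d = tree_verts d"
  proof
    show "tree_verts d \<subseteq> ?s ` tree_verts d"
    proof
      fix w assume w: "w \<in> tree_verts d"
      have gv: "g v \<in> tree_verts d" using v permutes_in_image[OF p] by blast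
      let ?z = "inv_into UNIV g (g v @ w)"
      have z: "?z \<in> tree_verts d"
        using permutes_in_image[OF permutes_inv[OF p], of "g v @ w"] gv w by simp
      have gz: "g ?z = g v @ w" by (rule permutes_inverses(1)[OF p])
      obtain u where "?z = inv_into UNIV g (g v) @ u"
        using tree_aut_append[OF tree_aut_inv_closed[OF g], of "g v" w] gv w by auto
      hence zu: "?z = v @ u" by (simp add: permutes_inverses[OF p])
      hence u: "u \<in> tree_verts d" using z by simp
      have "?s u = w" using app[OF u] gz zu by simp
      thus "w \<in> ?s ` tree_verts d" using u by blast
    qed
  qed (use mem in auto)
  ultimately have "?s permutes tree_verts d"
    by (intro bij_imp_permutes) (auto simp: bij_betw_def tree_section_def)
  moreover have "?s [] = []" by (simp add: tree_section_def)
  moreover have "tree_adj (?s a) (?s b) \<longleftrightarrow> tree_adj a b"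
    if ab: "a \<in> tree_verts d" "b \<in> tree_verts d" for a b
  proof -
    have pre: "tree_adj (c @ a) (c @ b) \<longleftrightarrow> tree_adj a b" for c a b
      by (simp add: tree_adj_def)
    have "tree_adj (g (v @ a)) (g (v @ b)) \<longleftrightarrow> tree_adj (v @ a) (v @ b)"
      using g v ab by (simp add: tree_aut_carrier)
    thus ?thesis by (simp add: app ab pre)
  qed
  ultimately show ?thesis by (auto simp: tree_aut_carrier)
qed

lemma first_level_perm_eq:
  assumes "g \<in> carrier (tree_aut d)" "x \<in> {1..d}"
  shows "g [x] = [first_level_perm d g x]"
  using tree_aut_child[OF assms(1), of "[]" x] assms by (auto simp: tree_aut_carrier first_level_perm_def)

lemma first_level_perm_closed:
  assumes g: "g \<in> carrier (tree_aut d)"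
  shows "first_level_perm d g \<in> carrier (sym_group d)"
proof -
  have p: "g permutes tree_verts d" using g by (simp add: tree_aut_carrier)
  have mem: "first_level_perm d g x \<in> {1..d}" if "x \<in> {1..d}" for x
    using permutes_in_image[OF p, of "[x]"] first_level_perm_eq[OF g that] that by simp
  have inj: "inj_on (first_level_perm d g) {1..d}"
    by (rule inj_onI) (metis first_level_perm_eq[OF g] permutes_inj[OF p] injD list.inject)
  have "first_level_perm d g ` {1..d} = {1..d}"
    by (rule endo_inj_surj) (use mem inj in auto)
  thus ?thesis unfolding sym_group_carrier
    by (intro bij_imp_permutes) (use inj in \<open>auto simp: bij_betw_def first_level_perm_def\<close>)
qed

lemma iterated_wreath_full: "iterated_wreath d (carrier (sym_group d)) = carrier (tree_aut d)"
  by (auto simp: iterated_wreath_def first_level_perm_closed tree_section_closed)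

lemma first_level_perm_section_comp:
  assumes g: "g \<in> carrier (tree_aut d)" and h: "h \<in> carrier (tree_aut d)"
    and v: "v \<in> tree_verts d"
  shows "first_level_perm d (tree_section d (g \<circ> h) v) =
    first_level_perm d (tree_section d g (h v)) \<circ> first_level_perm d (tree_section d h v)"
proof
  fix x
  let ?sh = "tree_section d h v" and ?sg = "tree_section d g (h v)"
  have hv: "h v \<in> tree_verts d"
    using h v by (simp add: tree_aut_carrier permutes_in_image)
  note sh = tree_section_closed[OF h v] and sg = tree_section_closed[OF g hv]
    and sgh = tree_section_closed[OF tree_aut_comp_closed[OF g h] v]
  show "first_level_perm d (tree_section d (g \<circ> h) v) x =
    (first_level_perm d ?sg \<circ> first_level_perm d ?sh) x"
  proof (cases "x \<in> {1..d}")
    case True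
    let ?y = "first_level_perm d ?sh x"
    have y: "?y \<in> {1..d}"
      using first_level_perm_closed[OF sh] True unfolding sym_group_carrier
      by (simp only: permutes_in_image)
    have "(g \<circ> h) (v @ [x]) = g (h v @ ?sh [x])"
      using tree_section_append[OF h v, of "[x]"] True by simp
    also have "\<dots> = g (h v @ [?y])"
      by (simp only: first_level_perm_eq[OF sh True])
    also have "\<dots> = g (h v) @ ?sg [?y]"
      using tree_section_append[OF g hv, of "[?y]"] y by simp
    also have "\<dots> = g (h v) @ [first_level_perm d ?sg ?y]"
      by (simp only: first_level_perm_eq[OF sg y])
    finally have "tree_section d (g \<circ> h) v [x] = [first_level_perm d ?sg ?y]"
      using tree_section_append[OF tree_aut_comp_closed[OF g h] v, of "[x]"] True by simp
    thus ?thesis using first_level_perm_eq[OF sgh True] by simp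
  next
    case False
    hence "first_level_perm d f x = x" for f by (simp only: first_level_perm_def if_False)
    thus ?thesis by simp
  qed
qed

lemma subgroup_iterated_wreath:
  assumes P: "subgroup P (sym_group d)"
  shows "subgroup (iterated_wreath d P) (tree_aut d)"
proof -
  interpret A: group "tree_aut d" by (rule group_tree_aut)
  interpret S: group "sym_group d" by (rule sym_group_is_group)
  have in_image: "g v \<in> tree_verts d" if "g \<in> carrier (tree_aut d)" "v \<in> tree_verts d" for g v
    using that by (simp add: tree_aut_carrier permutes_in_image)
  have one: "first_level_perm d (tree_section d id v) = id" for v
    by (auto simp: first_level_perm_def tree_section_def fun_eq_iff)
  show ?thesis
  proof (rule A.subgroupI)
    show "iterated_wreath d P \<subseteq> carrier (tree_aut d)" by (auto simp: iterated_wreath_def)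
    have "id \<in> iterated_wreath d P"
      using subgroup.one_closed[OF P]
      by (simp add: iterated_wreath_def id_in_tree_aut one sym_group_one)
    thus "iterated_wreath d P \<noteq> {}" by blast
  next
    fix g h assume "g \<in> iterated_wreath d P" "h \<in> iterated_wreath d P"
    thus "g \<otimes>\<^bsub>tree_aut d\<^esub> h \<in> iterated_wreath d P"
      using subgroup.m_closed[OF P]
      by (simp add: iterated_wreath_def tree_aut_comp_closed first_level_perm_section_comp
          in_image sym_group_mult)
  next
    fix g assume "g \<in> iterated_wreath d P"
    hence g: "g \<in> carrier (tree_aut d)"
      and gP: "\<And>v. v \<in> tree_verts d \<Longrightarrow> first_level_perm d (tree_section d g v) \<in> P"
      by (auto simp: iterated_wreath_def)
    let ?h = "inv\<^bsub>tree_aut d\<^esub> g"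
    have h: "?h \<in> carrier (tree_aut d)" and gh: "g \<circ> ?h = id"
      using A.inv_closed[OF g] A.r_inv[OF g] by simp_all
    have "first_level_perm d (tree_section d ?h v) \<in> P" if v: "v \<in> tree_verts d" for v
    proof -
      let ?a = "first_level_perm d (tree_section d g (?h v))"
        and ?b = "first_level_perm d (tree_section d ?h v)"
      have a: "?a \<in> P" using gP in_image[OF h v] by blast
      have "?a \<in> carrier (sym_group d)" using subgroup.mem_carrier[OF P a] .
      moreover have "?b \<in> carrier (sym_group d)"
        by (intro first_level_perm_closed tree_section_closed h v)
      moreover have "?a \<otimes>\<^bsub>sym_group d\<^esub> ?b = \<one>\<^bsub>sym_group d\<^esub>"
        using first_level_perm_section_comp[OF g h v] gh
        by (simp add: sym_group_mult sym_group_one one)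
      ultimately have "inv\<^bsub>sym_group d\<^esub> ?a = ?b"
        using S.inv_equality S.inv_comm by blast
      thus ?thesis using subgroup.m_inv_closed[OF P a] by simp
    qed
    thus "?h \<in> iterated_wreath d P" using h by (simp add: iterated_wreath_def)
  qed
qed

lemma openin_tree_aut_topology:
  "openin (tree_aut_topology d) U \<longleftrightarrow> U \<subseteq> carrier (tree_aut d) \<and>
     (\<forall>g\<in>U. \<exists>n. g <#\<^bsub>tree_aut d\<^esub> level_stab d n \<subseteq> U)"
proof -
  have "g v = v" if g: "g \<in> level_stab d n" and "m \<le> n" "v \<in> tree_verts d" "length v = m" for g m n v
  proof (cases "d = 0")
    case True
    thus ?thesis using that by (auto simp: tree_verts_def level_stab_def tree_aut_carrier)
  next
    case False
    let ?w = "replicate (n - m) (1::nat)"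
    have w: "?w \<in> tree_verts d" using False by (auto simp: tree_verts_def)
    have gc: "g \<in> carrier (tree_aut d)" using g by (simp add: level_stab_def)
    have "length (v @ ?w) = n" using that by simp
    hence "g (v @ ?w) = v @ ?w" using g w that unfolding level_stab_def by fastforce
    moreover have "v @ ?w \<in> tree_verts d" using that w by simp
    hence "\<exists>u. length u = length ?w \<and> g (v @ ?w) = g v @ u"
      by (rule tree_aut_append[OF gc])
    then obtain u where "g (v @ ?w) = g v @ u" "length u = length ?w"
      by blast
    ultimately show ?thesis by auto
  qed
  hence mono: "level_stab d n \<subseteq> level_stab d m" if "m \<le> n" for m n
    using that unfolding level_stab_def by blast
  have "istopology (\<lambda>U. U \<subseteq> carrier (tree_aut d) \<and>
     (\<forall>g\<in>U. \<exists>n. g <#\<^bsub>tree_aut d\<^esub> level_stab d n \<subseteq> U))"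
    unfolding istopology_def
  proof (intro conjI allI impI ballI)
    fix S T g
    assume S: "S \<subseteq> carrier (tree_aut d) \<and> (\<forall>g\<in>S. \<exists>n. g <#\<^bsub>tree_aut d\<^esub> level_stab d n \<subseteq> S)"
      and T: "T \<subseteq> carrier (tree_aut d) \<and> (\<forall>g\<in>T. \<exists>n. g <#\<^bsub>tree_aut d\<^esub> level_stab d n \<subseteq> T)"
      and g: "g \<in> S \<inter> T"
    then obtain m n where mn: "g <#\<^bsub>tree_aut d\<^esub> level_stab d m \<subseteq> S"
      "g <#\<^bsub>tree_aut d\<^esub> level_stab d n \<subseteq> T" by blast
    have "g <#\<^bsub>tree_aut d\<^esub> level_stab d (max m n) \<subseteq> S \<inter> T"
      using mn mono[of m "max m n"] mono[of n "max m n"] unfolding l_coset_def by fastforce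
    thus "\<exists>n. g <#\<^bsub>tree_aut d\<^esub> level_stab d n \<subseteq> S \<inter> T" ..
  next
    fix K g
    assume K: "\<forall>U\<in>K. U \<subseteq> carrier (tree_aut d) \<and>
        (\<forall>g\<in>U. \<exists>n. g <#\<^bsub>tree_aut d\<^esub> level_stab d n \<subseteq> U)"
      and "g \<in> \<Union>K"
    then obtain U where "U \<in> K" "g \<in> U" by blast
    with K obtain n where "g <#\<^bsub>tree_aut d\<^esub> level_stab d n \<subseteq> U" by blast
    with \<open>U \<in> K\<close> show "\<exists>n. g <#\<^bsub>tree_aut d\<^esub> level_stab d n \<subseteq> \<Union>K" by blast
  qed blast+
  thus ?thesis by (simp add: tree_aut_topology_def)
qed

lemma topspace_tree_aut_topology [simp]: "topspace (tree_aut_topology d) = carrier (tree_aut d)"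
proof -
  have "openin (tree_aut_topology d) (carrier (tree_aut d))"
    by (auto simp: openin_tree_aut_topology l_coset_def level_stab_def tree_aut_comp_closed)
  moreover have "topspace (tree_aut_topology d) \<subseteq> carrier (tree_aut d)"
    using openin_topspace[of "tree_aut_topology d"] unfolding openin_tree_aut_topology by blast
  ultimately show ?thesis using openin_subset by blast
qed

lemma topspace_wreath_topology [simp]: "topspace (wreath_topology d P) = iterated_wreath d P"
  by (auto simp: iterated_wreath_def)

end

theory Submission
  imports Defs "HOL-Algebra.FiniteProduct"
begin

text \<open>
  If \<open>P\<close> is not perfect, multiplying the labels of level \<open>n\<close> in \<open>P / P'\<close> gives for each \<open>n\<close> a
  continuous homomorphism from \<open>W\<close> to the finite group \<open>P / P'\<close>. The common kernel is a non-trivial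
  closed normal subgroup of infinite index; infinitely many distinct continuous homomorphisms to a
  finite group exclude topological finite generation; and an accumulation point of them is a
  homomorphism whose kernel has finite index but is not open.

  If \<open>P\<close> is perfect, then \<open>W\<close> is perfect as an abstract group: there is a bound \<open>K\<close> such that every
  element is a product of \<open>K\<close> commutators. This holds modulo every level stabilizer by induction on
  the level, and passes to the limit by compactness. A normal subgroup \<open>N\<close> containing an element that
  moves a vertex \<open>v\<close> contains the commutators of the copy of \<open>W\<close> acting below \<open>v\<close>, hence this copy,
  hence by transitivity the stabilizer of the level of \<open>v\<close>. So every non-trivial normal subgroup is
  open, which gives just-infiniteness and, via normal cores, strong completeness. Topological
  generators are the rooted elements together with two families of directed elements.
\<close>

subsection \<open>Products of commutators, cosets and normal cores\<close>

text \<open>Strong completeness brings in normal subgroups \<open>N\<close> that are not known to be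
  closed, so density of the commutator subgroup of W would be too weak: it would only place the copy
  of W below a vertex inside the closure of \<open>N\<close>. A limit of products of commutators is
  again such a product once the number of factors is bounded, because then the factors themselves
  can be made to accumulate. The obstacle is a bound that does not grow with the level: collecting
  the branches below one letter costs \<open>d\<close> commutators and the root permutation costs
  \<open>k\<close>, the width of \<open>P\<close>, at every level. The remedy is that commutators
  below two different letters multiply componentwise, so that \<open>2 * m\<close> of them in one
  copy cost only \<open>m\<close> after being spread over two copies, at the price of two more for
  the spreading. The width \<open>2 * m\<close> therefore reproduces itself as soon as
  \<open>d + 2 + m + k = 2 * m\<close>.\<close>

definition commutator :: "('a, 'b) monoid_scheme \<Rightarrow> 'a \<Rightarrow> 'a \<Rightarrow> 'a" where
  "commutator G x y = x \<otimes>\<^bsub>G\<^esub> y \<otimes>\<^bsub>G\<^esub> inv\<^bsub>G\<^esub> x \<otimes>\<^bsub>G\<^esub> inv\<^bsub>G\<^esub> y"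

text \<open>Trivial commutators are allowed, so these are the products of at most \<open>n\<close>
  commutators. The explicit count is what the limit argument requires.\<close>

primrec comm_prods :: "('a, 'b) monoid_scheme \<Rightarrow> nat \<Rightarrow> 'a set" where
  "comm_prods G 0 = {\<one>\<^bsub>G\<^esub>}"
| "comm_prods G (Suc n) = {commutator G x y \<otimes>\<^bsub>G\<^esub> c | x y c.
     x \<in> carrier G \<and> y \<in> carrier G \<and> c \<in> comm_prods G n}"

lemma comm_prods_SucI:
  "x \<in> carrier G \<Longrightarrow> y \<in> carrier G \<Longrightarrow> c \<in> comm_prods G n \<Longrightarrow>
    commutator G x y \<otimes>\<^bsub>G\<^esub> c \<in> comm_prods G (Suc n)"
  by auto

context group
begin

lemma commutator_closed [simp, intro]:
  "x \<in> carrier G \<Longrightarrow> y \<in> carrier G \<Longrightarrow> commutator G x y \<in> carrier G"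
  by (simp add: commutator_def)

lemma inv_commutator:
  "x \<in> carrier G \<Longrightarrow> y \<in> carrier G \<Longrightarrow> inv (commutator G x y) = commutator G y x"
  by (simp add: commutator_def inv_mult_group m_assoc)

lemma mult_inv_cancel_left:
  "x \<in> carrier G \<Longrightarrow> y \<in> carrier G \<Longrightarrow> x \<otimes> (inv x \<otimes> y) = y"
  "x \<in> carrier G \<Longrightarrow> y \<in> carrier G \<Longrightarrow> inv x \<otimes> (x \<otimes> y) = y"
  by (simp_all add: m_assoc[symmetric])

lemma conj_commutator:
  assumes "g \<in> carrier G" "x \<in> carrier G" "y \<in> carrier G"
  shows "g \<otimes> commutator G x y \<otimes> inv g = commutator G (g \<otimes> x \<otimes> inv g) (g \<otimes> y \<otimes> inv g)"
  using assms by (simp add: commutator_def inv_mult_group m_assoc mult_inv_cancel_left)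

lemma comm_prods_closed: "c \<in> comm_prods G n \<Longrightarrow> c \<in> carrier G"
  by (induction n arbitrary: c) auto

lemma commutator_comm_prods:
  "x \<in> carrier G \<Longrightarrow> y \<in> carrier G \<Longrightarrow> commutator G x y \<in> comm_prods G 1"
  using comm_prods_SucI[of x G y \<one> 0] by simp

lemma comm_prods_mult:
  "a \<in> comm_prods G m \<Longrightarrow> b \<in> comm_prods G n \<Longrightarrow> a \<otimes> b \<in> comm_prods G (m + n)"
proof (induction m arbitrary: a)
  case 0
  thus ?case using comm_prods_closed by auto
next
  case (Suc m)
  then obtain x y c where *: "a = commutator G x y \<otimes> c" "x \<in> carrier G" "y \<in> carrier G"
    "c \<in> comm_prods G m" by auto
  have "a \<otimes> b = commutator G x y \<otimes> (c \<otimes> b)"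
    using * Suc.prems comm_prods_closed by (simp add: m_assoc)
  thus ?case using * Suc.IH[OF *(4) Suc.prems(2)] by auto
qed

lemma comm_prods_split:
  "c \<in> comm_prods G (m + n) \<Longrightarrow> \<exists>a\<in>comm_prods G m. \<exists>b\<in>comm_prods G n. c = a \<otimes> b"
proof (induction m arbitrary: c)
  case 0
  thus ?case using comm_prods_closed by auto
next
  case (Suc m)
  then obtain x y e where *: "c = commutator G x y \<otimes> e" "x \<in> carrier G" "y \<in> carrier G"
    "e \<in> comm_prods G (m + n)" by auto
  from Suc.IH[OF *(4)] obtain a b where ab: "a \<in> comm_prods G m" "b \<in> comm_prods G n" "e = a \<otimes> b"
    by blast
  have "c = (commutator G x y \<otimes> a) \<otimes> b"
    using * ab comm_prods_closed by (simp add: m_assoc)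
  moreover have "commutator G x y \<otimes> a \<in> comm_prods G (Suc m)" using * ab by auto
  ultimately show ?case using ab by blast
qed

lemma one_comm_prods: "\<one> \<in> comm_prods G n"
proof (induction n)
  case (Suc n)
  have "\<one> = commutator G \<one> \<one> \<otimes> \<one>" by (simp add: commutator_def)
  thus ?case using comm_prods_SucI[OF one_closed one_closed Suc] by simp
qed simp

lemma comm_prods_mono: "m \<le> n \<Longrightarrow> comm_prods G m \<subseteq> comm_prods G n"
proof
  fix c assume "m \<le> n" "c \<in> comm_prods G m"
  thus "c \<in> comm_prods G n"
    using comm_prods_mult[OF _ one_comm_prods, of c m "n - m"] comm_prods_closed[of c m] by simp
qed

lemma comm_prods_inv: "c \<in> comm_prods G n \<Longrightarrow> inv c \<in> comm_prods G n"
proof (induction n arbitrary: c)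
  case (Suc n)
  then obtain x y e where *: "c = commutator G x y \<otimes> e" "x \<in> carrier G" "y \<in> carrier G"
    "e \<in> comm_prods G n" by auto
  have "inv c = inv e \<otimes> commutator G y x"
    using * comm_prods_closed by (simp add: inv_mult_group inv_commutator)
  thus ?case
    using comm_prods_mult[OF Suc.IH[OF *(4)] commutator_comm_prods[OF *(3,2)]] by simp
qed simp

lemma comm_prods_conj:
  "c \<in> comm_prods G n \<Longrightarrow> g \<in> carrier G \<Longrightarrow> g \<otimes> c \<otimes> inv g \<in> comm_prods G n"
proof (induction n arbitrary: c)
  case (Suc n)
  then obtain x y e where *: "c = commutator G x y \<otimes> e" "x \<in> carrier G" "y \<in> carrier G"
    "e \<in> comm_prods G n" by auto
  have "g \<otimes> c \<otimes> inv g = (g \<otimes> commutator G x y \<otimes> inv g) \<otimes> (g \<otimes> e \<otimes> inv g)"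
    using * Suc.prems(2) comm_prods_closed by (simp add: m_assoc mult_inv_cancel_left)
  thus ?case
    using conj_commutator[OF Suc.prems(2) *(2,3)] * Suc.prems(2)
      comm_prods_SucI[of "g \<otimes> x \<otimes> inv g" G "g \<otimes> y \<otimes> inv g", OF _ _ Suc.IH[OF *(4) Suc.prems(2)]]
    by simp
qed simp

text \<open>Two commuting copies share their commutators, which halves the width.\<close>

lemma comm_prods_commuting_homs:
  assumes a: "a \<in> hom G G" and b: "b \<in> hom G G"
    and ab: "\<And>x y. x \<in> carrier G \<Longrightarrow> y \<in> carrier G \<Longrightarrow> a x \<otimes> b y = b y \<otimes> a x"
  shows "c \<in> comm_prods G n \<Longrightarrow> e \<in> comm_prods G n \<Longrightarrow> a c \<otimes> b e \<in> comm_prods G n"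
proof (induction n arbitrary: c e)
  interpret a: group_hom G G a using a by unfold_locales
  interpret b: group_hom G G b using b by unfold_locales
  {
    case 0
    thus ?case by simp
  next
    case (Suc n)
    from Suc.prems obtain x y c' where c: "c = commutator G x y \<otimes> c'" "x \<in> carrier G" "y \<in> carrier G"
      "c' \<in> comm_prods G n" by auto
    from Suc.prems obtain u v e' where e: "e = commutator G u v \<otimes> e'" "u \<in> carrier G" "v \<in> carrier G"
      "e' \<in> comm_prods G n" by auto
    note cl = c(2-) e(2-) comm_prods_closed[OF c(4)] comm_prods_closed[OF e(4)]
    have ba: "b y \<otimes> (a x \<otimes> z) = a x \<otimes> (b y \<otimes> z)"
      if "x \<in> carrier G" "y \<in> carrier G" "z \<in> carrier G" for x y z
      using that ab[of x y] by (simp add: m_assoc[symmetric])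
    have "a c \<otimes> b e = a (commutator G x y) \<otimes> b (commutator G u v) \<otimes> (a c' \<otimes> b e')"
      using cl ba[of c' "commutator G u v" "b e'"] by (simp add: c(1) e(1) m_assoc)
    moreover have "a (commutator G x y) \<otimes> b (commutator G u v) = commutator G (a x \<otimes> b u) (a y \<otimes> b v)"
    proof -
      have "commutator G (a x \<otimes> b u) (a y \<otimes> b v) =
        a x \<otimes> (b u \<otimes> (a y \<otimes> (b v \<otimes> (b (inv u) \<otimes> (a (inv x) \<otimes> (b (inv v) \<otimes> a (inv y)))))))"
        using cl by (simp add: commutator_def inv_mult_group m_assoc)
      also have "\<dots> = a x \<otimes> (a y \<otimes> (a (inv x) \<otimes> (a (inv y) \<otimes> (b u \<otimes> (b v \<otimes> (b (inv u) \<otimes> b (inv v)))))))"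
        using cl by (simp add: ba ab[symmetric] del: a.hom_inv b.hom_inv)
      also have "\<dots> = a (commutator G x y) \<otimes> b (commutator G u v)"
        using cl by (simp add: commutator_def m_assoc)
      finally show ?thesis ..
    qed
    ultimately show ?case using comm_prods_SucI[OF _ _ Suc.IH[OF c(4) e(4)], of "a x \<otimes> b u" "a y \<otimes> b v"] cl
      by (simp del: comm_prods.simps) }
qed

lemma generate_derived_set_comm_prods:
  assumes "x \<in> generate G (derived_set G (carrier G))"
  shows "\<exists>n. x \<in> comm_prods G n"
  using assms
proof (induction rule: generate.induct)
  case one
  thus ?case using one_comm_prods by blast
next
  case (incl h)
  thus ?case using commutator_comm_prods unfolding commutator_def by blast
next
  case (inv h)
  thus ?case using commutator_comm_prods comm_prods_inv unfolding commutator_def by blast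
next
  case (eng h1 h2)
  thus ?case using comm_prods_mult by blast
qed

text \<open>Each element has some width, the sets \<open>comm_prods G n\<close> increase with
  \<open>n\<close>, and finitely many widths have a maximum.\<close>

lemma finite_perfect_comm_prods:
  assumes fin: "finite (carrier G)" and perf: "derived G (carrier G) = carrier G"
  shows "\<exists>n. carrier G \<subseteq> comm_prods G n"
proof -
  have "\<forall>x\<in>carrier G. \<exists>n. x \<in> comm_prods G n"
    using generate_derived_set_comm_prods perf by (simp add: derived_def)
  then obtain f where f: "\<And>x. x \<in> carrier G \<Longrightarrow> x \<in> comm_prods G (f x)" by metis
  have "x \<in> comm_prods G (Max (f ` carrier G))" if "x \<in> carrier G" for x
    using comm_prods_mono[of "f x" "Max (f ` carrier G)"] f[OF that] that fin by auto
  thus ?thesis by blast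
qed

end

lemma (in group_hom) commutator_image:
  "x \<in> carrier G \<Longrightarrow> y \<in> carrier G \<Longrightarrow> h (commutator G x y) = commutator H (h x) (h y)"
  by (simp add: commutator_def)

lemma (in group_hom) comm_prods_image:
  "c \<in> comm_prods G n \<Longrightarrow> h c \<in> comm_prods H n"
proof (induction n arbitrary: c)
  case (Suc n)
  then obtain x y e where *: "c = commutator G x y \<otimes> e" "x \<in> carrier G" "y \<in> carrier G"
    "e \<in> comm_prods G n" by auto
  thus ?case
    using comm_prods_SucI[of "h x" H "h y", OF _ _ Suc.IH[OF *(4)]] G.comm_prods_closed[OF *(4)]
    by (simp add: commutator_image del: comm_prods.simps)
qed simp

section \<open>Finite index, normal cores, signs and pointwise accumulation\<close>

lemma (in group) coset_eq_iff:
  assumes N: "subgroup N G" and g: "g \<in> carrier G" and h: "h \<in> carrier G"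
  shows "N #> g = N #> h \<longleftrightarrow> g \<otimes> inv h \<in> N"
proof
  assume "N #> g = N #> h"
  hence "N #> (g \<otimes> inv h) = N"
    using coset_mult_inv2[of N g h] g h subgroup.subset[OF N] by simp
  thus "g \<otimes> inv h \<in> N" using coset_join1[of N "g \<otimes> inv h"] N g h by simp
next
  assume "g \<otimes> inv h \<in> N"
  hence "N #> (g \<otimes> inv h) = N" using coset_join2 N g h by simp
  thus "N #> g = N #> h" using coset_mult_inv1[of N g h] g h subgroup.subset[OF N] by simp
qed

text \<open>A map whose fibres lie inside single cosets bounds the index by the number of its
  values. It serves for the action on a level as well as for a homomorphism into a finite
  group.\<close>

lemma (in group) finite_rcosets_if_finite_invariant:
  assumes N: "subgroup N G" and fin: "finite (F ` carrier G)"
    and F: "\<And>g h. g \<in> carrier G \<Longrightarrow> h \<in> carrier G \<Longrightarrow> F g = F h \<Longrightarrow> g \<otimes> inv h \<in> N"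
  shows "finite (rcosets N)"
proof -
  have "N #> g \<in> (\<lambda>r. N #> (SOME h. h \<in> carrier G \<and> F h = r)) ` F ` carrier G"
    if g: "g \<in> carrier G" for g
  proof -
    define h where "h = (SOME h. h \<in> carrier G \<and> F h = F g)"
    have "h \<in> carrier G \<and> F h = F g"
      unfolding h_def by (rule someI[of _ g]) (use g in simp)
    hence "N #> g = N #> h" using coset_eq_iff[OF N g, of h] F[of g h] g by simp
    thus ?thesis using g unfolding h_def by blast
  qed
  hence "rcosets N \<subseteq> (\<lambda>r. N #> (SOME h. h \<in> carrier G \<and> F h = r)) ` F ` carrier G"
    unfolding RCOSETS_def by blast
  thus ?thesis using fin finite_subset by blast
qed

text \<open>The core is the kernel of right multiplication on the finite set of cosets. It lies in
  \<open>H\<close> because it fixes the coset \<open>H\<close>; were it trivial, the group would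
  embed into the finite set of self-maps of \<open>rcosets H\<close>.\<close>

lemma (in group) normal_core_of_finite_index:
  assumes inf: "infinite (carrier G)" and H: "subgroup H G" and fin: "finite (rcosets H)"
  shows "\<exists>N. N \<lhd> G \<and> N \<noteq> {\<one>} \<and> N \<subseteq> H"
proof -
  have Hsub: "H \<subseteq> carrier G" using subgroup.subset[OF H] .
  have csub: "c \<subseteq> carrier G" if "c \<in> rcosets H" for c
    using that Hsub r_coset_subset_G unfolding RCOSETS_def by blast
  have cmult: "c #> g \<in> rcosets H" if c: "c \<in> rcosets H" and g: "g \<in> carrier G" for c g
  proof -
    obtain x where "x \<in> carrier G" "c = H #> x" using c unfolding RCOSETS_def by blast
    thus ?thesis using g Hsub rcosetsI[of H "x \<otimes> g"] by (simp add: coset_mult_assoc)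
  qed
  define N where "N = {g \<in> carrier G. \<forall>c\<in>rcosets H. c #> g = c}"
  have inv: "inv g \<in> N" if g: "g \<in> N" for g
  proof -
    have "c #> inv g = c" if c: "c \<in> rcosets H" for c
    proof -
      have "(c #> g) #> inv g = c"
        using csub[OF c] g by (simp add: coset_mult_assoc N_def)
      thus ?thesis using g c by (simp add: N_def)
    qed
    thus ?thesis using g by (simp add: N_def)
  qed
  have sub: "subgroup N G"
  proof (rule subgroupI)
    show "N \<noteq> {}" using csub by (auto simp: N_def intro!: exI[of _ \<one>])
    show "a \<otimes> b \<in> N" if "a \<in> N" "b \<in> N" for a b
      using that csub by (auto simp: N_def coset_mult_assoc[symmetric])
  qed (auto simp: inv, simp add: N_def)
  have norm: "N \<lhd> G"
    unfolding normal_inv_iff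
  proof (intro conjI ballI sub)
    fix x g assume x: "x \<in> carrier G" and g: "g \<in> N"
    have gc: "g \<in> carrier G" using g by (simp add: N_def)
    have "c #> (x \<otimes> g \<otimes> inv x) = c" if c: "c \<in> rcosets H" for c
    proof -
      have "c #> (x \<otimes> g \<otimes> inv x) = ((c #> x) #> g) #> inv x"
        using x gc csub[OF c] csub[OF cmult[OF c x]] csub[OF cmult[OF cmult[OF c x] gc]]
        by (simp add: coset_mult_assoc m_assoc)
      also have "(c #> x) #> g = c #> x" using g cmult[OF c x] by (simp add: N_def)
      also have "(c #> x) #> inv x = c" using x csub[OF c] by (simp add: coset_mult_assoc)
      finally show ?thesis .
    qed
    thus "x \<otimes> g \<otimes> inv x \<in> N" using x gc by (simp add: N_def)
  qed
  have H_rc: "H \<in> rcosets H" using rcosetsI[OF Hsub one_closed] Hsub by simp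
  have "N \<subseteq> H" using coset_join1[OF _ _ H] H_rc by (auto simp: N_def)
  moreover have "N \<noteq> {\<one>}"
  proof
    assume N1: "N = {\<one>}"
    let ?F = "\<lambda>g. restrict (\<lambda>c. c #> g) (rcosets H)"
    have "?F ` carrier G \<subseteq> rcosets H \<rightarrow>\<^sub>E rcosets H" using cmult by auto
    hence "finite (?F ` carrier G)" by (rule finite_subset) (simp add: fin finite_PiE)
    moreover have "inj_on ?F (carrier G)"
    proof (rule inj_onI)
      fix g h assume g: "g \<in> carrier G" and h: "h \<in> carrier G" and eq: "?F g = ?F h"
      have "c #> (g \<otimes> inv h) = c" if c: "c \<in> rcosets H" for c
      proof -
        have "c #> g = c #> h" using fun_cong[OF eq, of c] c by simp
        hence "(c #> g) #> inv h = (c #> h) #> inv h" by simp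
        thus ?thesis using g h csub[OF c] by (simp add: coset_mult_assoc)
      qed
      hence "g \<otimes> inv h \<in> N" using g h by (simp add: N_def)
      hence "g \<otimes> inv h = \<one>" using N1 by simp
      thus "g = h" using g h by (metis inv_closed inv_equality inv_inv)
    qed
    ultimately show False using inf finite_imageD by blast
  qed
  ultimately show ?thesis using norm by blast
qed

text \<open>Signs take values in a commutative group and are therefore trivial on commutators. This
  excludes \<open>d = 2\<close> for perfect \<open>P\<close>, and perfectness of the full symmetric
  group.\<close>

lemma sign_of_perfect:
  assumes sub: "P \<subseteq> carrier (sym_group d)" and perf: "derived (sym_group d) P = P" and p: "p \<in> P"
  shows "sign p = 1"
proof -
  interpret s: group_hom "sym_group d" sign_img sign by (rule sign_group_hom)
  interpret c: comm_group sign_img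
    by unfold_locales (auto simp: sign_img_def)
  have "sign ` P = {1}"
    using s.derived_img[OF sub] c.derived_eq_singleton[of "sign ` P"] s.hom_closed sub perf
    by (auto simp: sign_img_def)
  thus ?thesis using p by blast
qed

text \<open>Tychonoff for finite discrete factors: the closures of the tails of the sequence have a
  common point. As \<open>X\<close> may be uncountable, a convergent subsequence cannot be expected;
  what remains is agreement at arbitrarily late indices on each finite set.\<close>

lemma pointwise_accumulation:
  fixes \<phi> :: "nat \<Rightarrow> 'a \<Rightarrow> 'b"
  assumes fin: "\<And>x. x \<in> X \<Longrightarrow> finite (A x)" and \<phi>: "\<And>n x. x \<in> X \<Longrightarrow> \<phi> n x \<in> A x"
  shows "\<exists>\<psi>. \<forall>E N. finite E \<and> E \<subseteq> X \<longrightarrow> (\<exists>n\<ge>N. \<forall>x\<in>E. \<phi> n x = \<psi> x)"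
proof -
  define T where "T = product_topology (\<lambda>x. discrete_topology (A x)) X"
  define F where "F = (\<lambda>N. T closure_of ((\<lambda>n. restrict (\<phi> n) X) ` {N..}))"
  have comp: "compact_space T"
    unfolding T_def using fin
    by (auto simp: compact_space_product_topology compact_space_discrete_topology)
  have mem: "restrict (\<phi> n) X \<in> topspace T" for n
    using \<phi> by (auto simp: T_def)
  have "(\<Inter>N. F N) \<noteq> {}"
  proof (rule compact_space_imp_nest[OF comp])
    show "closedin T (F N)" for N by (simp add: F_def)
    show "F N \<noteq> {}" for N
    proof -
      have "(\<lambda>n. restrict (\<phi> n) X) ` {N..} \<subseteq> F N"
        unfolding F_def by (rule closure_of_subset) (use mem in auto)
      thus ?thesis by auto
    qed
    show "decseq F"
      unfolding F_def decseq_def by (intro allI impI closure_of_mono) auto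
  qed
  then obtain \<psi> where \<psi>: "\<And>N. \<psi> \<in> F N" by blast
  have "\<exists>n\<ge>N. \<forall>x\<in>E. \<phi> n x = \<psi> x" if E: "finite E" "E \<subseteq> X" for E N
  proof -
    have top: "\<psi> \<in> topspace T" using \<psi>[of 0] unfolding F_def by (simp add: in_closure_of)
    hence \<psi>A: "\<psi> x \<in> A x" if "x \<in> X" for x using that by (auto simp: T_def)
    let ?U = "PiE X (\<lambda>x. if x \<in> E then {\<psi> x} else A x)"
    have "openin T ?U"
      unfolding T_def by (rule product_topology_basis) (use E \<psi>A in \<open>auto intro: finite_subset\<close>)
    moreover have "\<psi> \<in> ?U" using top \<psi>A by (auto simp: T_def PiE_iff)
    ultimately obtain y where y: "y \<in> (\<lambda>n. restrict (\<phi> n) X) ` {N..}" "y \<in> ?U"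
      using \<psi>[of N] unfolding F_def in_closure_of by blast
    then obtain n where n: "n \<ge> N" "y = restrict (\<phi> n) X" by auto
    have "\<phi> n x = \<psi> x" if "x \<in> E" for x
      using PiE_mem[OF y(2), of x] that E n by auto
    thus ?thesis using n by blast
  qed
  thus ?thesis by blast
qed

subsection \<open>Tree automorphisms and their portraits\<close>

fun act :: "(nat list \<Rightarrow> nat \<Rightarrow> nat) \<Rightarrow> nat list \<Rightarrow> nat list" where
  "act L [] = []"
| "act L (x # w) = L [] x # act (\<lambda>v. L (x # v)) w"

definition portrait_aut :: "nat \<Rightarrow> (nat list \<Rightarrow> nat \<Rightarrow> nat) \<Rightarrow> nat list \<Rightarrow> nat list" where
  "portrait_aut d L w = (if w \<in> tree_verts d then act L w else w)"

definition portrait :: "nat \<Rightarrow> (nat list \<Rightarrow> nat list) \<Rightarrow> nat list \<Rightarrow> nat \<Rightarrow> nat" where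
  "portrait d g v = first_level_perm d (tree_section d g v)"

text \<open>The wreath recursion: \<open>p\<close> is the permutation at the root and
  \<open>f x\<close> the section at \<open>x\<close>, indexed by the letter before \<open>p\<close>
  is applied. Inductions on the level run along this form.\<close>

definition node ::
    "nat \<Rightarrow> (nat \<Rightarrow> nat) \<Rightarrow> (nat \<Rightarrow> nat list \<Rightarrow> nat list) \<Rightarrow> nat list \<Rightarrow> nat list" where
  "node d p f w = (if w \<in> tree_verts d then (case w of [] \<Rightarrow> [] | x # v \<Rightarrow> p x # f x v) else w)"

abbreviation sec :: "nat \<Rightarrow> (nat list \<Rightarrow> nat list) \<Rightarrow> nat \<Rightarrow> nat list \<Rightarrow> nat list" where
  "sec d g x \<equiv> tree_section d g [x]"

definition agree :: "nat \<Rightarrow> nat \<Rightarrow> (nat list \<Rightarrow> nat list) \<Rightarrow> (nat list \<Rightarrow> nat list) \<Rightarrow> bool" where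
  "agree d n g h \<longleftrightarrow> (\<forall>v\<in>tree_verts d. length v = n \<longrightarrow> g v = h v)"

lemma length_act [simp]: "length (act L w) = length w"
  by (induction L w rule: act.induct) auto

lemma act_snoc: "act L (v @ [x]) = act L v @ [L v x]"
  by (induction v arbitrary: L) auto

lemma act_in_verts:
  assumes "\<And>v. v \<in> tree_verts d \<Longrightarrow> L v permutes {1..d}" "w \<in> tree_verts d"
  shows "act L w \<in> tree_verts d"
  using assms
proof (induction w arbitrary: L)
  case (Cons x w)
  hence "act (\<lambda>v. L (x # v)) w \<in> tree_verts d" by simp
  moreover have "L [] x \<in> {1..d}" using Cons.prems permutes_in_image[of "L []" "{1..d}" x] by simp
  ultimately show ?case by simp
qed simp

lemma act_inj:
  assumes "\<And>v. v \<in> tree_verts d \<Longrightarrow> L v permutes {1..d}"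
    "v \<in> tree_verts d" "w \<in> tree_verts d" "act L v = act L w"
  shows "v = w"
  using assms
proof (induction v arbitrary: L w)
  case Nil
  thus ?case by (metis act.simps(1) length_act length_0_conv)
next
  case (Cons x v)
  then obtain y u where w: "w = y # u" by (metis act.simps(1) act.simps(2) list.distinct(1) list.exhaust)
  have xy: "x = y"
    using Cons.prems w permutes_inj[of "L []" "{1..d}"] by (auto dest: injD)
  have "v = u" using Cons.prems w xy by (intro Cons.IH[of "\<lambda>v. L (x # v)"]) auto
  thus ?case using w xy by simp
qed

lemma finite_level: "finite {v \<in> tree_verts d. length v = n}"
  using finite_lists_length_eq[of "{1..d}" n] by (simp add: tree_verts_def lists_eq_set)

text \<open>Surjectivity comes from counting: \<open>act\<close> keeps lengths and is injective on
  each level, which is finite.\<close>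

lemma portrait_aut_permutes:
  assumes L: "\<And>v. v \<in> tree_verts d \<Longrightarrow> L v permutes {1..d}"
  shows "portrait_aut d L permutes tree_verts d"
proof (rule bij_imp_permutes)
  have "act L ` {v \<in> tree_verts d. length v = n} = {v \<in> tree_verts d. length v = n}" for n
  proof (rule endo_inj_surj[OF finite_level])
    show "act L ` {v \<in> tree_verts d. length v = n} \<subseteq> {v \<in> tree_verts d. length v = n}"
      using act_in_verts[OF L] by auto
    show "inj_on (act L) {v \<in> tree_verts d. length v = n}"
      by (rule inj_onI, rule act_inj[OF L]) auto
  qed
  hence "w \<in> act L ` {v \<in> tree_verts d. length v = length w}" if "w \<in> tree_verts d" for w
    using that by simp
  hence "act L ` tree_verts d = tree_verts d" using act_in_verts[of d L] L by auto
  hence "bij_betw (act L) (tree_verts d) (tree_verts d)"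
    unfolding bij_betw_def by (intro conjI inj_onI) (rule act_inj[of d L], use L in auto)
  thus "bij_betw (portrait_aut d L) (tree_verts d) (tree_verts d)"
    by (subst bij_betw_cong[of _ _ "act L"]) (auto simp: portrait_aut_def)
qed (simp add: portrait_aut_def)

lemma portrait_aut_in_tree_aut:
  assumes L: "\<And>v. v \<in> tree_verts d \<Longrightarrow> L v permutes {1..d}"
  shows "portrait_aut d L \<in> carrier (tree_aut d)"
proof -
  have "tree_adj (act L u) (act L v) \<longleftrightarrow> tree_adj u v"
    if u: "u \<in> tree_verts d" and v: "v \<in> tree_verts d" for u v
  proof -
    have child: "(\<exists>x. act L v = act L u @ [x]) \<longleftrightarrow> (\<exists>x. v = u @ [x])"
      if u: "u \<in> tree_verts d" and v: "v \<in> tree_verts d" for u v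
    proof
      assume "\<exists>x. act L v = act L u @ [x]"
      then obtain x where x: "act L v = act L u @ [x]" ..
      hence "length v = Suc (length u)" by (metis length_act length_append_singleton)
      then obtain v' y where v': "v = v' @ [y]" by (metis length_Suc_conv_rev)
      hence "act L v' = act L u" using x by (simp add: act_snoc)
      thus "\<exists>x. v = u @ [x]" using act_inj[OF L] u v v' by auto
    qed (auto simp: act_snoc)
    show ?thesis unfolding tree_adj_def using child[OF u v] child[OF v u] by simp
  qed
  thus ?thesis
    using portrait_aut_permutes[of d L] L by (auto simp: tree_aut_carrier portrait_aut_def)
qed

lemma portrait_portrait_aut:
  assumes L: "\<And>v. v \<in> tree_verts d \<Longrightarrow> L v permutes {1..d}" and v: "v \<in> tree_verts d"
  shows "portrait d (portrait_aut d L) v = L v"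
proof
  fix x show "portrait d (portrait_aut d L) v x = L v x"
    using v permutes_not_in[OF L[OF v], of x]
    by (auto simp: portrait_def first_level_perm_def tree_section_def portrait_aut_def act_snoc)
qed

lemma portrait_aut_portrait:
  assumes g: "g \<in> carrier (tree_aut d)"
  shows "portrait_aut d (portrait d g) = g"
proof
  fix w
  show "portrait_aut d (portrait d g) w = g w"
  proof (cases "w \<in> tree_verts d")
    case True
    hence "act (portrait d g) w = g w"
    proof (induction w rule: rev_induct)
      case Nil
      show ?case using g by (simp add: tree_aut_carrier)
    next
      case (snoc x v)
      hence v: "v \<in> tree_verts d" and x: "x \<in> {1..d}" by auto
      show ?case
        using snoc.IH[OF v] tree_section_append[OF g v, of "[x]"] x
          first_level_perm_eq[OF tree_section_closed[OF g v] x]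
        by (simp add: act_snoc portrait_def)
    qed
    thus ?thesis using True by (simp add: portrait_aut_def)
  next
    case False
    thus ?thesis using g by (auto simp: portrait_aut_def tree_aut_carrier permutes_def)
  qed
qed

section \<open>The group W and its recursive decomposition\<close>

locale wreath =
  fixes d :: nat and P :: "(nat \<Rightarrow> nat) set"
  assumes d2: "d \<ge> 2" and P: "subgroup P (sym_group d)" and trans: "transitive_perms d P"
begin

definition G :: "(nat list \<Rightarrow> nat list) monoid" where
  "G = wreath_group d P"

abbreviation "T \<equiv> tree_verts d"

lemma P_permutes: "p \<in> P \<Longrightarrow> p permutes {1..d}"
  using subgroup.mem_carrier[OF P] by (simp add: sym_group_carrier)

lemma P_mem: "p \<in> P \<Longrightarrow> p x \<in> {1..d} \<longleftrightarrow> x \<in> {1..d}"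
  by (rule permutes_in_image[OF P_permutes])

lemma P_eq_iff: "p \<in> P \<Longrightarrow> p x = p y \<longleftrightarrow> x = y"
  using permutes_inj[OF P_permutes] by (simp add: inj_eq)

lemma id_P [simp]: "id \<in> P"
  using subgroup.one_closed[OF P] by (simp add: sym_group_one)

lemma comp_P [simp]: "p \<in> P \<Longrightarrow> q \<in> P \<Longrightarrow> p \<circ> q \<in> P"
  using subgroup.m_closed[OF P] by (simp add: sym_group_mult)

lemma inv_P: "p \<in> P \<Longrightarrow> inv' p \<in> P"
  using subgroup.m_inv_closed[OF P] subgroup.mem_carrier[OF P] by fastforce

lemma finite_P: "finite P"
  by (rule finite_subset[of _ "{p. p permutes {1..d}}"])
    (use P_permutes finite_permutations[of "{1..d}"] in auto)

lemma carrier_G: "carrier G = iterated_wreath d P"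
  and mult_G: "g \<otimes>\<^bsub>G\<^esub> h = g \<circ> h"
  and one_G: "\<one>\<^bsub>G\<^esub> = id"
  by (simp_all add: G_def)

sublocale G: group G
  unfolding G_def
  using group.subgroup_imp_group[OF group_tree_aut subgroup_iterated_wreath[OF P]] .

lemma G_tree_aut: "g \<in> carrier G \<Longrightarrow> g \<in> carrier (tree_aut d)"
  by (simp add: carrier_G iterated_wreath_def)

lemma G_permutes: "g \<in> carrier G \<Longrightarrow> g permutes T"
  using G_tree_aut by (simp add: tree_aut_carrier)

lemma G_mem: "g \<in> carrier G \<Longrightarrow> g v \<in> T \<longleftrightarrow> v \<in> T"
  by (rule permutes_in_image[OF G_permutes])

lemma G_not_in: "g \<in> carrier G \<Longrightarrow> v \<notin> T \<Longrightarrow> g v = v"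
  using G_permutes permutes_not_in by metis

lemma G_Nil [simp]: "g \<in> carrier G \<Longrightarrow> g [] = []"
  using G_tree_aut by (simp add: tree_aut_carrier)

lemma G_length: "g \<in> carrier G \<Longrightarrow> length (g v) = length v"
  using tree_aut_append[OF G_tree_aut, of g "[]" v] G_not_in[of g v] by (cases "v \<in> T") auto

lemma id_G [simp]: "id \<in> carrier G"
  using G.one_closed by (simp add: one_G)

lemma comp_G [simp]: "g \<in> carrier G \<Longrightarrow> h \<in> carrier G \<Longrightarrow> g \<circ> h \<in> carrier G"
  using G.m_closed by (simp add: mult_G)

lemma inv_G_cancel: "g \<in> carrier G \<Longrightarrow> g ((inv\<^bsub>G\<^esub> g) v) = v" "g \<in> carrier G \<Longrightarrow> (inv\<^bsub>G\<^esub> g) (g v) = v"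
  using G.r_inv[of g] G.l_inv[of g] by (auto simp: mult_G one_G fun_eq_iff)

lemma portrait_aut_G:
  assumes "\<And>v. v \<in> T \<Longrightarrow> L v \<in> P"
  shows "portrait_aut d L \<in> carrier G"
  using portrait_aut_in_tree_aut[of d L] portrait_portrait_aut[of d L] assms P_permutes
  by (auto simp: carrier_G iterated_wreath_def portrait_def)

lemma portrait_P: "g \<in> carrier G \<Longrightarrow> v \<in> T \<Longrightarrow> portrait d g v \<in> P"
  by (auto simp: carrier_G iterated_wreath_def portrait_def)

lemma node_conv_portrait_aut:
  assumes f: "\<And>x. x \<in> {1..d} \<Longrightarrow> f x \<in> carrier G"
  shows "node d p f = portrait_aut d (\<lambda>v. case v of [] \<Rightarrow> p | x # u \<Rightarrow> portrait d (f x) u)"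
proof
  fix w
  show "node d p f w = portrait_aut d (\<lambda>v. case v of [] \<Rightarrow> p | x # u \<Rightarrow> portrait d (f x) u) w"
  proof (cases w)
    case (Cons x v)
    have "act (portrait d (f x)) v = f x v" if "x \<in> {1..d}" "v \<in> T"
      using portrait_aut_portrait[OF G_tree_aut[OF f[OF that(1)]]] that(2)
      by (metis portrait_aut_def)
    thus ?thesis using Cons by (auto simp: node_def portrait_aut_def)
  qed (simp add: node_def portrait_aut_def)
qed

lemma node_closed:
  assumes p: "p \<in> P" and f: "\<And>x. x \<in> {1..d} \<Longrightarrow> f x \<in> carrier G"
  shows "node d p f \<in> carrier G"
proof -
  have "portrait_aut d (\<lambda>v. case v of [] \<Rightarrow> p | x # u \<Rightarrow> portrait d (f x) u) \<in> carrier G"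
    by (rule portrait_aut_G) (use p portrait_P[OF f] in \<open>auto split: list.split\<close>)
  thus ?thesis using node_conv_portrait_aut[of f p] f by simp
qed

lemma root_node:
  assumes "p \<in> P"
  shows "first_level_perm d (node d p f) = p"
  using permutes_not_in[OF P_permutes[OF assms]] by (auto simp: first_level_perm_def node_def)

lemma sec_node:
  assumes f: "f x \<in> carrier G" and x: "x \<in> {1..d}"
  shows "sec d (node d p f) x = f x"
proof
  fix w show "sec d (node d p f) x w = f x w"
    using x f G_Nil[of "f x"] G_not_in[OF f, of w] by (auto simp: tree_section_def node_def)
qed

lemma node_cong: "p = q \<Longrightarrow> (\<And>x. x \<in> {1..d} \<Longrightarrow> f x = h x) \<Longrightarrow> node d p f = node d q h"
  by (auto simp: node_def fun_eq_iff split: list.split)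

lemma node_eta:
  assumes g: "g \<in> carrier G"
  shows "first_level_perm d g \<in> P" "\<And>x. x \<in> {1..d} \<Longrightarrow> sec d g x \<in> carrier G"
    "node d (first_level_perm d g) (sec d g) = g"
proof -
  define f where "f = (\<lambda>x. portrait_aut d (\<lambda>v. portrait d g (x # v)))"
  have f: "f x \<in> carrier G" if "x \<in> {1..d}" for x
    unfolding f_def using that by (intro portrait_aut_G portrait_P[OF g]) simp
  have p: "portrait d g [] \<in> P" using portrait_P[OF g] by simp
  have "portrait_aut d (portrait d g) w = node d (portrait d g []) f w" for w
    by (cases w) (auto simp: portrait_aut_def node_def f_def)
  \<comment> \<open>With \<open>g\<close> written as a node built from its portrait, the root
    permutation and the sections can be read off from that node.\<close>
  hence eq: "g = node d (portrait d g []) f"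
    using portrait_aut_portrait[OF G_tree_aut[OF g]] by (metis ext)
  have r: "first_level_perm d g = portrait d g []" by (subst eq) (rule root_node[OF p])
  have s: "sec d g x = f x" if "x \<in> {1..d}" for x
    by (subst eq) (rule sec_node[of f x, OF f[OF that] that])
  show "first_level_perm d g \<in> P" using r p by simp
  show "sec d g x \<in> carrier G" if "x \<in> {1..d}" for x using s f that by simp
  show "node d (first_level_perm d g) (sec d g) = g"
    using node_cong[OF r s] eq by simp
qed

lemma node_cases:
  assumes "g \<in> carrier G"
  obtains p f where "p \<in> P" "\<And>x. f x \<in> carrier G" "g = node d p f"
proof
  show "first_level_perm d g \<in> P" by (rule node_eta[OF assms])
  \<comment> \<open>Padding with \<open>id\<close> makes \<open>f x\<close> an element of the group
    for every \<open>x\<close>, so later uses carry no side condition on letters.\<close>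
  show "(if x \<in> {1..d} then sec d g x else id) \<in> carrier G" for x
    using node_eta[OF assms] by simp
  show "g = node d (first_level_perm d g) (\<lambda>x. if x \<in> {1..d} then sec d g x else id)"
    by (subst node_eta(3)[OF assms, symmetric]) (rule node_cong, auto)
qed

lemma node_mult:
  assumes q: "q \<in> P" and h: "\<And>x. x \<in> {1..d} \<Longrightarrow> h x \<in> carrier G"
  shows "node d p f \<otimes>\<^bsub>G\<^esub> node d q h = node d (p \<circ> q) (\<lambda>x. f (q x) \<otimes>\<^bsub>G\<^esub> h x)"
proof
  fix w show "(node d p f \<otimes>\<^bsub>G\<^esub> node d q h) w = node d (p \<circ> q) (\<lambda>x. f (q x) \<otimes>\<^bsub>G\<^esub> h x) w"
    using P_mem[OF q] G_mem[OF h] by (cases w) (auto simp: node_def mult_G)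
qed

lemma node_one: "node d id (\<lambda>_. id) = \<one>\<^bsub>G\<^esub>"
  by (auto simp: node_def one_G fun_eq_iff split: list.split)

section \<open>Rooted elements and copies of W below a vertex\<close>

definition rooted :: "(nat \<Rightarrow> nat) \<Rightarrow> nat list \<Rightarrow> nat list" where
  "rooted p = node d p (\<lambda>_. id)"

definition below :: "nat \<Rightarrow> (nat list \<Rightarrow> nat list) \<Rightarrow> nat list \<Rightarrow> nat list" where
  "below x a = node d id (\<lambda>y. if y = x then a else id)"

text \<open>For a vertex \<open>v\<close> this embeds W onto the rigid stabilizer of
  \<open>v\<close>, the elements that move only vertices below \<open>v\<close>.\<close>

primrec below_vertex :: "nat list \<Rightarrow> (nat list \<Rightarrow> nat list) \<Rightarrow> nat list \<Rightarrow> nat list" where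
  "below_vertex [] a = a"
| "below_vertex (x # v) a = below x (below_vertex v a)"

lemma rooted_closed [simp]: "p \<in> P \<Longrightarrow> rooted p \<in> carrier G"
  by (simp add: rooted_def node_closed)

lemma below_closed [simp]: "a \<in> carrier G \<Longrightarrow> below x a \<in> carrier G"
  by (simp add: below_def node_closed)

lemma below_vertex_closed [simp]: "a \<in> carrier G \<Longrightarrow> below_vertex v a \<in> carrier G"
  by (induction v) auto

lemma rooted_mult: "q \<in> P \<Longrightarrow> rooted p \<otimes>\<^bsub>G\<^esub> rooted q = rooted (p \<circ> q)"
  by (simp add: rooted_def node_mult) (simp add: mult_G)

lemma rooted_hom: "group_hom (sym_group d\<lparr>carrier := P\<rparr>) G rooted"
proof -
  interpret S: group "sym_group d\<lparr>carrier := P\<rparr>"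
    using group.subgroup_imp_group[OF sym_group_is_group P] .
  show ?thesis
    by unfold_locales (auto simp: hom_def rooted_mult sym_group_mult)
qed

lemma below_mult:
  "a \<in> carrier G \<Longrightarrow> b \<in> carrier G \<Longrightarrow> below x (a \<otimes>\<^bsub>G\<^esub> b) = below x a \<otimes>\<^bsub>G\<^esub> below x b"
  unfolding below_def by (subst node_mult) (auto simp: mult_G intro!: node_cong)

lemma below_hom: "below x \<in> hom G G"
  by (auto simp: hom_def below_mult)

lemma below_one [simp]: "below x \<one>\<^bsub>G\<^esub> = \<one>\<^bsub>G\<^esub>"
  unfolding below_def by (subst node_one[symmetric], rule node_cong) (auto simp: one_G)

lemma below_inv: "a \<in> carrier G \<Longrightarrow> below x (inv\<^bsub>G\<^esub> a) = inv\<^bsub>G\<^esub> (below x a)"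
  using group_hom.hom_inv[of G G "below x" a] below_hom by (simp add: group_hom_def group_hom_axioms_def)

lemma below_commute:
  "x \<noteq> y \<Longrightarrow> a \<in> carrier G \<Longrightarrow> b \<in> carrier G \<Longrightarrow>
    below x a \<otimes>\<^bsub>G\<^esub> below y b = below y b \<otimes>\<^bsub>G\<^esub> below x a"
  unfolding below_def by (simp add: node_mult, rule node_cong) (auto simp: mult_G)

lemma rooted_below:
  "p \<in> P \<Longrightarrow> a \<in> carrier G \<Longrightarrow> rooted p \<otimes>\<^bsub>G\<^esub> below x a = below (p x) a \<otimes>\<^bsub>G\<^esub> rooted p"
  unfolding below_def rooted_def
  by (simp add: node_mult, rule node_cong) (auto simp: mult_G P_eq_iff)

lemma rooted_below_conj:
  "p \<in> P \<Longrightarrow> a \<in> carrier G \<Longrightarrow> rooted p \<otimes>\<^bsub>G\<^esub> below x a \<otimes>\<^bsub>G\<^esub> inv\<^bsub>G\<^esub> (rooted p) = below (p x) a"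
  by (simp add: rooted_below G.m_assoc)

text \<open>The right factor acts first, so the branches are met at the letters already permuted by
  \<open>q\<close>; this accounts for the inverse.\<close>

lemma node_decomp:
  "q \<in> P \<Longrightarrow> (\<And>x. x \<in> {1..d} \<Longrightarrow> f x \<in> carrier G) \<Longrightarrow>
    node d q f = node d id (\<lambda>x. f (inv' q x)) \<otimes>\<^bsub>G\<^esub> rooted q"
  unfolding rooted_def
  by (subst node_mult) (auto simp: mult_G permutes_inverses[OF P_permutes] intro!: node_cong)

lemma below_vertex_hom: "below_vertex v \<in> hom G G"
  using below_hom by (induction v) (auto simp: hom_def)

text \<open>The supports are disjoint subtrees. A common prefix is stripped by the homomorphism
  property until the first letter that differs.\<close>

lemma below_vertex_commute:
  "v \<noteq> u \<Longrightarrow> length v = length u \<Longrightarrow> a \<in> carrier G \<Longrightarrow> b \<in> carrier G \<Longrightarrow>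
    below_vertex v a \<otimes>\<^bsub>G\<^esub> below_vertex u b = below_vertex u b \<otimes>\<^bsub>G\<^esub> below_vertex v a"
proof (induction v arbitrary: u)
  case (Cons x v)
  then obtain y w where u: "u = y # w" by (cases u) auto
  show ?case
  proof (cases "x = y")
    case True
    hence "below_vertex v a \<otimes>\<^bsub>G\<^esub> below_vertex w b = below_vertex w b \<otimes>\<^bsub>G\<^esub> below_vertex v a"
      using Cons u by auto
    thus ?thesis using u True Cons.prems by (simp add: below_mult[symmetric])
  next
    case False
    thus ?thesis using u Cons.prems by (simp add: below_commute)
  qed
qed simp

text \<open>Conjugation by \<open>g\<close> carries the copy at \<open>v\<close> to the copy at
  \<open>g v\<close>; \<open>b\<close> is the conjugate of \<open>a\<close> by the section of
  \<open>g\<close> at \<open>v\<close>. The form without inverses matches \<open>node_mult\<close>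
  in the induction.\<close>

lemma below_vertex_conj:
  "g \<in> carrier G \<Longrightarrow> v \<in> T \<Longrightarrow> a \<in> carrier G \<Longrightarrow>
    \<exists>b\<in>carrier G. g \<otimes>\<^bsub>G\<^esub> below_vertex v a = below_vertex (g v) b \<otimes>\<^bsub>G\<^esub> g"
proof (induction v arbitrary: g)
  case Nil
  thus ?case
    by (intro bexI[of _ "g \<otimes>\<^bsub>G\<^esub> a \<otimes>\<^bsub>G\<^esub> inv\<^bsub>G\<^esub> g"]) (simp_all add: G.m_assoc)
next
  case (Cons x v)
  from node_cases[OF Cons.prems(1)] obtain p f
    where g: "p \<in> P" "\<And>x. f x \<in> carrier G" "g = node d p f" by metis
  have x: "x \<in> {1..d}" and v: "v \<in> T" using Cons.prems by auto
  from Cons.IH[OF g(2)[of x] v Cons.prems(3)] obtain b where b: "b \<in> carrier G"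
    "f x \<otimes>\<^bsub>G\<^esub> below_vertex v a = below_vertex (f x v) b \<otimes>\<^bsub>G\<^esub> f x" by blast
  have gx: "g (x # v) = p x # f x v" using g x v by (simp add: node_def)
  have "g \<otimes>\<^bsub>G\<^esub> below x (below_vertex v a) = below (p x) (below_vertex (f x v) b) \<otimes>\<^bsub>G\<^esub> g"
    unfolding below_def g(3) using g Cons.prems b
    by (simp add: node_mult, intro node_cong) (auto simp: P_eq_iff, auto simp: mult_G)
  thus ?case using b gx by auto
qed

lemma level_transitive:
  "v \<in> T \<Longrightarrow> u \<in> T \<Longrightarrow> length v = length u \<Longrightarrow> \<exists>g\<in>carrier G. g v = u"
proof (induction v arbitrary: u)
  case Nil
  thus ?case by (auto intro!: bexI[of _ id])
next
  case (Cons x v)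
  then obtain y w where u: "u = y # w" "w \<in> T" "y \<in> {1..d}" by (cases u) auto
  have "\<exists>g\<in>carrier G. g v = w" using Cons.prems u by (intro Cons.IH) auto
  then obtain g where g: "g \<in> carrier G" "g v = w" by blast
  obtain p where p: "p \<in> P" "p x = y"
    using trans Cons.prems(1) u unfolding transitive_perms_def tree_verts_simps by blast
  show ?case
    using p g u Cons.prems by (intro bexI[of _ "node d p (\<lambda>_. g)"] node_closed) (auto simp: node_def)
qed

section \<open>Agreement on a level, the topology of W and its compactness\<close>

lemma agree_refl [simp]: "agree d n g g" by (simp add: agree_def)

lemma agree_sym: "agree d n g h \<Longrightarrow> agree d n h g" by (simp add: agree_def)

lemma agree_trans [trans]: "agree d n g h \<Longrightarrow> agree d n h k \<Longrightarrow> agree d n g k"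
  by (simp add: agree_def)

lemma agree_0: "g \<in> carrier G \<Longrightarrow> h \<in> carrier G \<Longrightarrow> agree d 0 g h"
  by (simp add: agree_def)

lemma agree_Suc_node:
  assumes "p \<in> P" "q \<in> P"
  shows "agree d (Suc n) (node d p f) (node d q h) \<longleftrightarrow> p = q \<and> (\<forall>x\<in>{1..d}. agree d n (f x) (h x))"
proof
  assume a: "agree d (Suc n) (node d p f) (node d q h)"
  have *: "p x = q x \<and> f x v = h x v" if "x \<in> {1..d}" "v \<in> T" "length v = n" for x v
    using a[unfolded agree_def, rule_format, of "x # v"] that by (simp add: node_def)
  have "p x = q x" for x
  proof (cases "x \<in> {1..d}")
    case True
    \<comment> \<open>Comparing the root permutations at \<open>x\<close> requires some word of
      length \<open>n\<close> to follow that letter.\<close>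
    have "replicate n 1 \<in> T" using d2 by (auto simp: tree_verts_def)
    thus ?thesis using *[OF True] by fastforce
  next
    case False
    thus ?thesis using permutes_not_in P_permutes assms by metis
  qed
  thus "p = q \<and> (\<forall>x\<in>{1..d}. agree d n (f x) (h x))" using * by (auto simp: agree_def)
next
  assume "p = q \<and> (\<forall>x\<in>{1..d}. agree d n (f x) (h x))"
  thus "agree d (Suc n) (node d p f) (node d q h)"
    by (auto simp: agree_def node_def split: list.split)
qed

lemma agree_mono: "g \<in> carrier G \<Longrightarrow> h \<in> carrier G \<Longrightarrow> agree d n g h \<Longrightarrow> m \<le> n \<Longrightarrow> agree d m g h"
proof (induction m arbitrary: g h n)
  case (Suc m)
  then obtain k where k: "n = Suc k" "m \<le> k" by (cases n) auto
  obtain p f where g: "p \<in> P" "\<And>x. f x \<in> carrier G" "g = node d p f"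
    using node_cases[OF Suc.prems(1)] by metis
  obtain q e where h: "q \<in> P" "\<And>x. e x \<in> carrier G" "h = node d q e"
    using node_cases[OF Suc.prems(2)] by metis
  show ?case using Suc.prems(3) Suc.IH[OF g(2) h(2) _ k(2)] k g h by (simp add: agree_Suc_node)
qed (simp add: agree_0)

lemma agree_mult:
  "g' \<in> carrier G \<Longrightarrow> h' \<in> carrier G \<Longrightarrow> agree d n g g' \<Longrightarrow> agree d n h h' \<Longrightarrow>
    agree d n (g \<otimes>\<^bsub>G\<^esub> h) (g' \<otimes>\<^bsub>G\<^esub> h')"
  using G_mem[of h'] G_length[of h'] by (simp add: agree_def mult_G)

lemma agree_inv:
  assumes "g \<in> carrier G" "h \<in> carrier G" "agree d n g h"
  shows "agree d n (inv\<^bsub>G\<^esub> g) (inv\<^bsub>G\<^esub> h)"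
  unfolding agree_def
proof (intro ballI impI)
  fix v assume v: "v \<in> T" "length v = n"
  let ?w = "(inv\<^bsub>G\<^esub> g) v"
  have "?w \<in> T" "length ?w = n" using v G_mem[of "inv\<^bsub>G\<^esub> g"] G_length[of "inv\<^bsub>G\<^esub> g"] assms by auto
  hence "h ?w = v" using assms inv_G_cancel(1)[OF assms(1), of v] by (simp add: agree_def)
  thus "?w = (inv\<^bsub>G\<^esub> h) v" using inv_G_cancel(2)[OF assms(2), of ?w] by simp
qed

lemma agree_commutator:
  "x \<in> carrier G \<Longrightarrow> x' \<in> carrier G \<Longrightarrow> y \<in> carrier G \<Longrightarrow> y' \<in> carrier G \<Longrightarrow>
    agree d n x x' \<Longrightarrow> agree d n y y' \<Longrightarrow> agree d n (commutator G x y) (commutator G x' y')"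
  unfolding commutator_def by (intro agree_mult agree_inv) auto

lemma agree_all_eq: "g \<in> carrier G \<Longrightarrow> h \<in> carrier G \<Longrightarrow> (\<And>n. agree d n g h) \<Longrightarrow> g = h"
  by (metis agree_def ext G_not_in)

text \<open>A left coset of a level stabilizer consists of the elements with the same values on that
  level, so openness can be tested by \<open>agree\<close> inside W alone.\<close>

lemma openin_wreath_topology:
  "openin (wreath_topology d P) U \<longleftrightarrow> U \<subseteq> carrier G \<and>
    (\<forall>g\<in>U. \<exists>n. \<forall>h\<in>carrier G. agree d n g h \<longrightarrow> h \<in> U)"
proof
  assume "openin (wreath_topology d P) U"
  then obtain V where V: "openin (tree_aut_topology d) V" "U = V \<inter> carrier G"
    by (auto simp: openin_subtopology carrier_G)
  have "\<exists>n. \<forall>h\<in>carrier G. agree d n g h \<longrightarrow> h \<in> U" if g: "g \<in> U" for g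
  proof -
    obtain n where n: "g <#\<^bsub>tree_aut d\<^esub> level_stab d n \<subseteq> V"
      using V g unfolding openin_tree_aut_topology by blast
    have "h \<in> U" if h: "h \<in> carrier G" "agree d n g h" for h
    proof -
      have gG: "g \<in> carrier G" using V g by simp
      let ?s = "inv\<^bsub>G\<^esub> g \<otimes>\<^bsub>G\<^esub> h"
      have "?s \<in> carrier G" using gG h by simp
      moreover have "?s v = v" if "v \<in> T" "length v = n" for v
        using h that inv_G_cancel(2)[OF gG, of v] by (simp add: agree_def mult_G)
      ultimately have "?s \<in> level_stab d n" by (simp add: level_stab_def G_tree_aut)
      moreover have "g \<circ> ?s = h" using gG h by (simp add: mult_G[symmetric] G.mult_inv_cancel_left)
      ultimately have "h \<in> g <#\<^bsub>tree_aut d\<^esub> level_stab d n" 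
        unfolding l_coset_def by (auto intro!: bexI[of _ ?s])
      thus ?thesis using n V h by blast
    qed
    thus ?thesis by blast
  qed
  thus "U \<subseteq> carrier G \<and> (\<forall>g\<in>U. \<exists>n. \<forall>h\<in>carrier G. agree d n g h \<longrightarrow> h \<in> U)"
    using V by blast
next
  assume U: "U \<subseteq> carrier G \<and> (\<forall>g\<in>U. \<exists>n. \<forall>h\<in>carrier G. agree d n g h \<longrightarrow> h \<in> U)"
  \<comment> \<open>An open set of Aut(T) that cuts out \<open>U\<close>: the union of full
    agreement classes of elements of \<open>U\<close>, each taken at a level where the class inside
    W stays in \<open>U\<close>.\<close>
  define V where "V = {k \<in> carrier (tree_aut d). \<exists>g\<in>U. \<exists>n.
    (\<forall>h\<in>carrier G. agree d n g h \<longrightarrow> h \<in> U) \<and> agree d n g k}"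
  have "k \<circ> s \<in> V" if k: "k \<in> carrier (tree_aut d)" and g: "g \<in> U"
      and n: "\<forall>h\<in>carrier G. agree d n g h \<longrightarrow> h \<in> U" "agree d n g k" and s: "s \<in> level_stab d n"
    for k g n s
  proof -
    have "k \<circ> s \<in> carrier (tree_aut d)" using k s by (simp add: tree_aut_comp_closed level_stab_def)
    moreover have "agree d n g (k \<circ> s)" using n(2) s by (simp add: agree_def level_stab_def)
    ultimately show ?thesis using g n unfolding V_def by blast
  qed
  hence "openin (tree_aut_topology d) V"
    unfolding openin_tree_aut_topology l_coset_def by (fastforce simp: V_def)
  moreover have "U = V \<inter> iterated_wreath d P"
    using U G_tree_aut by (fastforce simp: V_def carrier_G)
  ultimately show "openin (wreath_topology d P) U" by (auto simp: openin_subtopology)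
qed

text \<open>W is closed because its definition restricts single labels: the label at
  \<open>v\<close> is visible on words of length \<open>Suc (length v)\<close>, hence is a label of
  some approximating \<open>g\<close> and lies in \<open>P\<close>. This is also how elements given
  by an infinite recursion are shown to lie in W.\<close>

lemma limit_closed:
  assumes g: "\<And>n. \<exists>g\<in>carrier G. \<forall>v\<in>T. length v \<le> n \<longrightarrow> a v = g v" and out: "\<And>v. v \<notin> T \<Longrightarrow> a v = v"
  shows "a \<in> carrier G"
proof -
  \<comment> \<open>The default \<open>x\<close> outside the alphabet makes \<open>L v\<close>
    coincide with a label as a total function.\<close>
  define L where "L = (\<lambda>v x. if x \<in> {1..d} then last (a (v @ [x])) else x)"
  have L: "L v = portrait d g v \<and> a (v @ [x]) = a v @ [portrait d g v x]"
    if v: "v \<in> T" and x: "x \<in> {1..d}" and gG: "g \<in> carrier G"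
      and ag: "\<forall>u\<in>T. length u \<le> Suc (length v) \<longrightarrow> a u = g u" for v x g
  proof -
    have *: "a (v @ [y]) = a v @ [portrait d g v y]" if y: "y \<in> {1..d}" for y
    proof -
      have "g (v @ [y]) = act (portrait d g) (v @ [y])" "g v = act (portrait d g) v"
        using portrait_aut_portrait[OF G_tree_aut[OF gG]] v y
        by (simp_all add: portrait_aut_def fun_eq_iff split: if_splits)
      thus ?thesis using ag v y by (simp add: act_snoc)
    qed
    hence "L v y = portrait d g v y" for y
      using permutes_not_in[OF P_permutes[OF portrait_P[OF gG v]], of y] by (auto simp: L_def)
    thus ?thesis using *[OF x] by blast
  qed
  have Lv: "L v \<in> P \<and> a (v @ [x]) = a v @ [L v x]" if v: "v \<in> T" and x: "x \<in> {1..d}" for v x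
  proof -
    obtain g where "g \<in> carrier G" "\<forall>u\<in>T. length u \<le> Suc (length v) \<longrightarrow> a u = g u"
      using g by blast
    thus ?thesis using L[OF v x] portrait_P v by auto
  qed
  have a0: "a [] = []" using g[of 0] by auto
  have "a w = act L w" if "w \<in> T" for w
    using that by (induction w rule: rev_induct) (simp_all add: a0 Lv act_snoc)
  hence "a = portrait_aut d L" using out by (auto simp: portrait_aut_def)
  moreover have "L v \<in> P" if "v \<in> T" for v using Lv[of v 1] that d2 by simp
  ultimately show ?thesis using portrait_aut_G by simp
qed

text \<open>Both sequences must accumulate along the same indices, since the commutator of
  \<open>x m\<close> and \<open>y m\<close> is to be controlled. They are therefore merged into one
  sequence of functions, with a boolean choosing between them; each value stays in the finite level
  of its argument.\<close>

lemma accumulation_pair: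
  assumes x: "\<And>n::nat. x n \<in> carrier G" and y: "\<And>n. y n \<in> carrier G"
  shows "\<exists>a\<in>carrier G. \<exists>b\<in>carrier G. \<forall>n. \<exists>m\<ge>n. agree d n (x m) a \<and> agree d n (y m) b"
proof -
  define \<phi> where "\<phi> = (\<lambda>n (c, v). (if c then x n else y n) v)"
  have "\<exists>\<psi>. \<forall>E N. finite E \<and> E \<subseteq> UNIV \<times> T \<longrightarrow> (\<exists>n\<ge>N. \<forall>e\<in>E. \<phi> n e = \<psi> e)"
    by (rule pointwise_accumulation[where A = "\<lambda>e. {v \<in> T. length v = length (snd e)}"])
      (auto simp: \<phi>_def finite_level G_mem G_length x y)
  then obtain \<psi> where \<psi>: "\<And>E N. finite E \<Longrightarrow> E \<subseteq> UNIV \<times> T \<Longrightarrow> \<exists>n\<ge>N. \<forall>e\<in>E. \<phi> n e = \<psi> e" by metis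
  define a where "a = (\<lambda>v. if v \<in> T then \<psi> (True, v) else v)"
  define b where "b = (\<lambda>v. if v \<in> T then \<psi> (False, v) else v)"
  have *: "\<exists>m\<ge>n. \<forall>v\<in>T. length v \<le> n \<longrightarrow> x m v = a v \<and> y m v = b v" for n
  proof -
    let ?B = "{v \<in> T. length v \<le> n}"
    have "?B = (\<Union>k\<le>n. {v \<in> T. length v = k})" by auto
    hence "finite ?B" using finite_level by simp
    hence "finite ((UNIV :: bool set) \<times> ?B)" by simp
    from \<psi>[OF this, of n] obtain m where m: "m \<ge> n" "\<forall>e\<in>UNIV \<times> ?B. \<phi> m e = \<psi> e" by auto
    have "x m v = a v \<and> y m v = b v" if "v \<in> T" "length v \<le> n" for v
      using m(2)[rule_format, of "(True, v)"] m(2)[rule_format, of "(False, v)"] that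
      by (simp add: \<phi>_def a_def b_def)
    thus ?thesis using m(1) by blast
  qed
  have "a \<in> carrier G"
  proof (rule limit_closed)
    fix n from *[of n] obtain m where "\<forall>v\<in>T. length v \<le> n \<longrightarrow> x m v = a v \<and> y m v = b v" by blast
    thus "\<exists>g\<in>carrier G. \<forall>v\<in>T. length v \<le> n \<longrightarrow> a v = g v"
      by (intro bexI[OF _ x[of m]]) simp
  qed (simp add: a_def)
  moreover have "b \<in> carrier G"
  proof (rule limit_closed)
    fix n from *[of n] obtain m where "\<forall>v\<in>T. length v \<le> n \<longrightarrow> x m v = a v \<and> y m v = b v" by blast
    thus "\<exists>g\<in>carrier G. \<forall>v\<in>T. length v \<le> n \<longrightarrow> b v = g v"
      by (intro bexI[OF _ y[of m]]) simp
  qed (simp add: b_def)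
  moreover have "\<exists>m\<ge>n. agree d n (x m) a \<and> agree d n (y m) b" for n
    using *[of n] unfolding agree_def by auto
  ultimately show ?thesis by blast
qed

end

subsection \<open>Perfect labels\<close>

primrec directed ::
    "(nat \<Rightarrow> nat) \<Rightarrow> nat \<Rightarrow> (nat \<Rightarrow> nat list \<Rightarrow> nat list) \<Rightarrow> nat list \<Rightarrow> nat list" where
  "directed p x f [] = []"
| "directed p x f (z # w) = p z # (if z = x then directed p x f w else f z w)"

context wreath
begin

text \<open>The equation has \<open>s\<close> on both sides. Recursion on the word solves it along
  the ray of letters \<open>x\<close>, and \<open>n\<close> nested nodes agree with the solution up
  to level \<open>n\<close>, so that \<open>limit_closed\<close> applies.\<close>

lemma directed_element:
  assumes p: "p \<in> P" and f: "\<And>z. f z \<in> carrier G"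
  shows "\<exists>s\<in>carrier G. s = node d p (\<lambda>z. if z = x then s else f z)"
proof
  let ?s = "\<lambda>w. if w \<in> T then directed p x f w else w"
  show "?s = node d p (\<lambda>z. if z = x then ?s else f z)"
    by (auto simp: fun_eq_iff node_def split: list.split)
  show "?s \<in> carrier G"
  proof (rule limit_closed)
    fix n show "\<exists>g\<in>carrier G. \<forall>v\<in>T. length v \<le> n \<longrightarrow> ?s v = g v"
    proof (induction n)
      case 0
      show ?case by (intro bexI[of _ id]) auto
    next
      case (Suc n)
      then obtain g where g: "g \<in> carrier G" "\<forall>v\<in>T. length v \<le> n \<longrightarrow> ?s v = g v" by blast
      have "?s v = node d p (\<lambda>z. if z = x then g else f z) v" if "v \<in> T" "length v \<le> Suc n" for v
        using that g(2) by (cases v) (auto simp: node_def)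
      thus ?case by (intro bexI[of _ "node d p (\<lambda>z. if z = x then g else f z)"])
        (auto intro!: node_closed simp: p f g(1))
    qed
  qed simp
qed

section \<open>Commutator width of W\<close>

primrec below_list :: "(nat \<times> (nat list \<Rightarrow> nat list)) list \<Rightarrow> nat list \<Rightarrow> nat list" where
  "below_list [] = \<one>\<^bsub>G\<^esub>"
| "below_list (e # l) = below (fst e) (snd e) \<otimes>\<^bsub>G\<^esub> below_list l"

primrec total :: "(nat \<times> (nat list \<Rightarrow> nat list)) list \<Rightarrow> nat list \<Rightarrow> nat list" where
  "total [] = \<one>\<^bsub>G\<^esub>"
| "total (e # l) = snd e \<otimes>\<^bsub>G\<^esub> total l"

lemma total_closed: "snd ` set l \<subseteq> carrier G \<Longrightarrow> total l \<in> carrier G"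
  by (induction l) auto

lemma below_list_subgroup:
  "subgroup H G \<Longrightarrow> (\<And>e. e \<in> set l \<Longrightarrow> below (fst e) (snd e) \<in> H) \<Longrightarrow> below_list l \<in> H"
  by (induction l) (auto simp: subgroup.one_closed subgroup.m_closed)

text \<open>The commutator of \<open>below x a\<close> with a rooted element taking \<open>x\<close> to 1 moves \<open>a\<close> from the letter
  \<open>x\<close> to the letter 1.\<close>

lemma below_list_collect:
  "fst ` set l \<subseteq> {1..d} \<Longrightarrow> snd ` set l \<subseteq> carrier G \<Longrightarrow>
    \<exists>c\<in>comm_prods G (length l). below_list l = c \<otimes>\<^bsub>G\<^esub> below 1 (total l)"
proof (induction l)
  case (Cons e l)
  obtain x a where e: "e = (x, a)" by force
  have a: "a \<in> carrier G" and x: "x \<in> {1..d}" using Cons.prems e by auto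
  from Cons obtain c where c: "c \<in> comm_prods G (length l)"
    "below_list l = c \<otimes>\<^bsub>G\<^esub> below 1 (total l)" by auto
  have tot: "total l \<in> carrier G" using Cons.prems by (simp add: total_closed)
  have cc: "c \<in> carrier G" using c G.comm_prods_closed by blast
  have "1 \<in> {1..d}" using d2 by simp
  then obtain t where t: "t \<in> P" "t x = 1"
    using trans x unfolding transitive_perms_def by blast
  let ?k = "commutator G (below x a) (rooted t)"
  have "?k = below x a \<otimes>\<^bsub>G\<^esub> (rooted t \<otimes>\<^bsub>G\<^esub> below x (inv\<^bsub>G\<^esub> a) \<otimes>\<^bsub>G\<^esub> inv\<^bsub>G\<^esub> (rooted t))"
    using a t by (simp add: commutator_def G.m_assoc below_inv)
  also have "\<dots> = below x a \<otimes>\<^bsub>G\<^esub> inv\<^bsub>G\<^esub> (below 1 a)"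
    using a t rooted_below_conj[of t "inv\<^bsub>G\<^esub> a" x] by (simp add: below_inv)
  finally have k: "below x a = ?k \<otimes>\<^bsub>G\<^esub> below 1 a"
    using a by (simp add: G.m_assoc)
  \<comment> \<open>Conjugating \<open>c\<close> moves it to the left of \<open>below 1 a\<close>,
    so that the factors below the letter 1 meet; the number of commutators is unchanged.\<close>
  let ?c = "below 1 a \<otimes>\<^bsub>G\<^esub> c \<otimes>\<^bsub>G\<^esub> inv\<^bsub>G\<^esub> (below 1 a)"
  have "below_list (e # l) = ?k \<otimes>\<^bsub>G\<^esub> below 1 a \<otimes>\<^bsub>G\<^esub> (c \<otimes>\<^bsub>G\<^esub> below 1 (total l))"
    using e c k by simp
  also have "\<dots> = ?k \<otimes>\<^bsub>G\<^esub> ?c \<otimes>\<^bsub>G\<^esub> below 1 (total (e # l))"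
    using a t cc tot e by (simp add: G.m_assoc below_mult G.mult_inv_cancel_left)
  finally have "below_list (e # l) = ?k \<otimes>\<^bsub>G\<^esub> ?c \<otimes>\<^bsub>G\<^esub> below 1 (total (e # l))" .
  moreover have "?k \<otimes>\<^bsub>G\<^esub> ?c \<in> comm_prods G (length (e # l))"
    using comm_prods_SucI[of "below x a" G "rooted t", OF _ _ G.comm_prods_conj[OF c(1), of "below 1 a"]]
      a t by (simp del: comm_prods.simps)
  ultimately show ?case by blast
qed (simp add: G.one_comm_prods one_G[symmetric])

lemma below_list_node:
  fixes f :: "nat \<Rightarrow> nat list \<Rightarrow> nat list" and xs :: "nat list"
  assumes f: "\<And>x. x \<in> {1..d} \<Longrightarrow> f x \<in> carrier G"
  shows "distinct xs \<Longrightarrow> set xs \<subseteq> {1..d} \<Longrightarrow>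
    below_list (map (\<lambda>x. (x, f x)) xs) = node d id (\<lambda>x. if x \<in> set xs then f x else id)"
proof (induction xs)
  case Nil
  show ?case by (simp only: list.map below_list.simps node_one list.set empty_iff if_False)
next
  case (Cons x xs)
  have "below x (f x) \<otimes>\<^bsub>G\<^esub> node d id (\<lambda>y. if y \<in> set xs then f y else id) =
      node d id (\<lambda>y. if y \<in> set (x # xs) then f y else id)"
    unfolding below_def using Cons.prems f
    by (subst node_mult) (auto simp: mult_G intro!: node_cong)
  moreover have "below_list (map (\<lambda>x. (x, f x)) xs) = node d id (\<lambda>y. if y \<in> set xs then f y else id)"
    by (rule Cons.IH) (use Cons.prems in auto)
  ultimately show ?case by (simp only: list.map below_list.simps fst_conv snd_conv)
qed

lemma node_below_list:
  assumes "\<And>x. x \<in> {1..d} \<Longrightarrow> f x \<in> carrier G"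
  shows "node d id f = below_list (map (\<lambda>x. (x, f x)) [1..<Suc d])"
  by (subst below_list_node[OF assms]) (auto intro!: node_cong)

text \<open>Products of a fixed number of commutators form a closed set: by compactness the first
  factors of the approximations accumulate at the commutator of some \<open>a\<close> and
  \<open>b\<close>, and what is left of \<open>g\<close> is approximated by products with one factor
  fewer.\<close>

lemma comm_prods_complete:
  "g \<in> carrier G \<Longrightarrow> (\<And>n. \<exists>c\<in>comm_prods G m. agree d n c g) \<Longrightarrow> g \<in> comm_prods G m"
proof (induction m arbitrary: g)
  case 0
  hence "agree d n \<one>\<^bsub>G\<^esub> g" for n by simp
  thus ?case using agree_all_eq[of "\<one>\<^bsub>G\<^esub>" g] 0 by simp
next
  case (Suc m)
  have "\<forall>n. \<exists>x y c. x \<in> carrier G \<and> y \<in> carrier G \<and> c \<in> comm_prods G m \<and>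
      agree d n (commutator G x y \<otimes>\<^bsub>G\<^esub> c) g"
  proof
    fix n
    obtain e where "e \<in> comm_prods G (Suc m)" "agree d n e g" using Suc.prems(2) by blast
    thus "\<exists>x y c. x \<in> carrier G \<and> y \<in> carrier G \<and> c \<in> comm_prods G m \<and>
      agree d n (commutator G x y \<otimes>\<^bsub>G\<^esub> c) g" by auto
  qed
  then obtain x y c where x: "\<And>n. x n \<in> carrier G" and y: "\<And>n. y n \<in> carrier G"
    and c: "\<And>n. c n \<in> comm_prods G m"
    and ag: "\<And>n. agree d n (commutator G (x n) (y n) \<otimes>\<^bsub>G\<^esub> c n) g" by metis
  have cc: "c n \<in> carrier G" for n using c G.comm_prods_closed by blast
  obtain a b where a: "a \<in> carrier G" and b: "b \<in> carrier G"
    and ab: "\<forall>n. \<exists>m\<ge>n. agree d n (x m) a \<and> agree d n (y m) b"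
    using accumulation_pair[of x y, OF x y] by (elim bexE)
  let ?h = "inv\<^bsub>G\<^esub> (commutator G a b) \<otimes>\<^bsub>G\<^esub> g"
  have "\<exists>e\<in>comm_prods G m. agree d n e ?h" for n
  proof -
    obtain k where k: "k \<ge> n" "agree d n (x k) a" "agree d n (y k) b"
      using ab[rule_format, of n] by (elim exE conjE)
    let ?k = "commutator G (x k) (y k)"
    have "agree d n (?k \<otimes>\<^bsub>G\<^esub> c k) g"
      using agree_mono[OF _ _ ag k(1)] x y cc Suc.prems(1) by simp
    moreover have "agree d n (inv\<^bsub>G\<^esub> ?k) (inv\<^bsub>G\<^esub> (commutator G a b))"
      using agree_inv agree_commutator x y a b k by simp
    ultimately have "agree d n (inv\<^bsub>G\<^esub> ?k \<otimes>\<^bsub>G\<^esub> (?k \<otimes>\<^bsub>G\<^esub> c k)) ?h"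
      using a b Suc.prems(1) by (intro agree_mult) auto
    hence "agree d n (c k) ?h" using x y cc by (simp add: G.mult_inv_cancel_left)
    thus ?thesis using c by blast
  qed
  hence "?h \<in> comm_prods G m" using Suc.prems(1) a b by (intro Suc.IH) auto
  hence "commutator G a b \<otimes>\<^bsub>G\<^esub> ?h \<in> comm_prods G (Suc m)" by (intro comm_prods_SucI a b)
  thus ?case using a b Suc.prems(1) by (simp add: G.mult_inv_cancel_left del: comm_prods.simps)
qed

text \<open>The width \<open>2 * m\<close> reproduces itself one level further down: a product of \<open>2 * m\<close>
  commutators collected below one letter is spread over the letters 1 and 2, where it costs only
  \<open>m\<close> commutators, which leaves room for the commutators used in collecting and for the root.\<close>

lemma comm_prods_approx:
  assumes k: "rooted ` P \<subseteq> comm_prods G k" and m: "m = d + 2 + k"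
  shows "g \<in> carrier G \<Longrightarrow> \<exists>c\<in>comm_prods G (2 * m). agree d n c g"
proof (induction n arbitrary: g)
  case 0
  thus ?case using G.one_comm_prods agree_0[OF G.one_closed] by blast
next
  case (Suc n)
  from node_cases[OF Suc.prems] obtain q f
    where g: "q \<in> P" "\<And>x. f x \<in> carrier G" "g = node d q f" by metis
  define b where "b = (\<lambda>x. f (inv' q x))"
  have b: "b x \<in> carrier G" for x using g by (simp add: b_def)
  have gb: "g = node d id b \<otimes>\<^bsub>G\<^esub> rooted q" unfolding b_def g(3) by (rule node_decomp) (use g in auto)
  \<comment> \<open>The branches 2 to \<open>d\<close>. Once all are collected at the letter 1, they
    leave the single element \<open>b 1 \<otimes> ?t\<close>, to which the induction hypothesis
    applies.\<close>
  let ?t = "total (map (\<lambda>x. (x, b x)) [2..<Suc d])"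
  have t: "?t \<in> carrier G" by (rule total_closed) (auto simp: b)
  have "b 1 \<otimes>\<^bsub>G\<^esub> ?t \<in> carrier G" using b t by simp
  from Suc.IH[OF this] obtain c where c: "c \<in> comm_prods G (m + m)" "agree d n c (b 1 \<otimes>\<^bsub>G\<^esub> ?t)"
    by (auto simp: mult_2)
  have cc: "c \<in> carrier G" using c G.comm_prods_closed by blast
  from G.comm_prods_split[OF c(1)] obtain c1 c2
    where c12: "c1 \<in> comm_prods G m" "c2 \<in> comm_prods G m" "c = c1 \<otimes>\<^bsub>G\<^esub> c2" by blast
  note c12c = c12(1,2)[THEN G.comm_prods_closed]
  \<comment> \<open>Only the branch at 1 is altered, so that the branches multiply to
    \<open>c\<close> exactly. On level \<open>n\<close> the change is invisible, because
    \<open>c\<close> agrees there with \<open>b 1 \<otimes> ?t\<close>.\<close>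
  define b' where "b' = b(1 := c \<otimes>\<^bsub>G\<^esub> inv\<^bsub>G\<^esub> ?t)"
  have b': "b' x \<in> carrier G" for x using b t cc by (simp add: b'_def)
  let ?l = "map (\<lambda>x. (x, b' x)) [1..<Suc d]"
  have "[1..<Suc d] = 1 # [2..<Suc d]" using d2 by (simp add: upt_conv_Cons numeral_2_eq_2)
  moreover have "map (\<lambda>x. (x, b' x)) [2..<Suc d] = map (\<lambda>x. (x, b x)) [2..<Suc d]"
    by (simp add: b'_def)
  ultimately have "total ?l = b' 1 \<otimes>\<^bsub>G\<^esub> ?t" 
    by (simp only: list.map total.simps snd_conv)
  hence tot: "total ?l = c" using t cc by (simp add: b'_def G.m_assoc)
  have "\<exists>e\<in>comm_prods G (length ?l). below_list ?l = e \<otimes>\<^bsub>G\<^esub> below 1 (total ?l)"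
    by (rule below_list_collect) (auto simp: b')
  then obtain e where e: "e \<in> comm_prods G d" "node d id b' = e \<otimes>\<^bsub>G\<^esub> below 1 c"
    using node_below_list[of b', OF b'] by (simp only: tot length_map length_upt) auto
  let ?l2 = "[(1 :: nat, c1), (2, c2)]"
  have "\<exists>e\<in>comm_prods G (length ?l2). below_list ?l2 = e \<otimes>\<^bsub>G\<^esub> below 1 (total ?l2)"
    by (rule below_list_collect) (use c12c d2 in auto)
  then obtain e' where e': "e' \<in> comm_prods G 2"
    "below 1 c1 \<otimes>\<^bsub>G\<^esub> below 2 c2 = e' \<otimes>\<^bsub>G\<^esub> below 1 c"
    using c12c c12 by (auto simp: numeral_2_eq_2 simp del: comm_prods.simps)
  note ec = G.comm_prods_closed[OF e(1)] G.comm_prods_closed[OF e'(1)]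
  let ?s = "below 1 c1 \<otimes>\<^bsub>G\<^esub> below 2 c2"
  have s: "?s \<in> comm_prods G m"
    by (rule G.comm_prods_commuting_homs[OF below_hom below_hom _ c12(1,2)]) (simp add: below_commute)
  have "e \<otimes>\<^bsub>G\<^esub> inv\<^bsub>G\<^esub> e' \<otimes>\<^bsub>G\<^esub> ?s = node d id b'"
    \<comment> \<open>Both \<open>node d id b'\<close> and \<open>?s\<close> are a few commutators
      times \<open>below 1 c\<close>. Eliminating that factor leaves \<open>d\<close> and 2
      commutators for collecting and the \<open>m\<close> of \<open>?s\<close>; the root adds
      \<open>k\<close>.\<close>
    unfolding e(2) e'(2) using ec cc by (simp add: G.m_assoc G.mult_inv_cancel_left)
  moreover have "e \<otimes>\<^bsub>G\<^esub> inv\<^bsub>G\<^esub> e' \<otimes>\<^bsub>G\<^esub> ?s \<otimes>\<^bsub>G\<^esub> rooted q \<in> comm_prods G (d + 2 + m + k)"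
    by (intro G.comm_prods_mult G.comm_prods_inv e(1) e'(1) s) (use k g in auto)
  ultimately have "node d id b' \<otimes>\<^bsub>G\<^esub> rooted q \<in> comm_prods G (d + 2 + m + k)"
    by metis
  moreover have "d + 2 + m + k = 2 * m" using m by simp
  ultimately have "node d id b' \<otimes>\<^bsub>G\<^esub> rooted q \<in> comm_prods G (2 * m)" by metis
  moreover have "agree d n (b' x) (b x)" for x
  proof -
    have "agree d n (c \<otimes>\<^bsub>G\<^esub> inv\<^bsub>G\<^esub> ?t) (b 1 \<otimes>\<^bsub>G\<^esub> ?t \<otimes>\<^bsub>G\<^esub> inv\<^bsub>G\<^esub> ?t)"
      by (rule agree_mult) (use b t c in auto)
    thus ?thesis using b[of 1] t by (simp add: b'_def G.m_assoc)
  qed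
  hence "agree d (Suc n) (node d id b' \<otimes>\<^bsub>G\<^esub> rooted q) g"
    unfolding gb by (intro agree_mult) (use g b in \<open>simp_all add: agree_Suc_node node_closed\<close>)
  ultimately show ?case by blast
qed

section \<open>Level stabilizers, infinitude and density\<close>

lemma exists_nontrivial_move: "g \<in> carrier G \<Longrightarrow> g \<noteq> \<one>\<^bsub>G\<^esub> \<Longrightarrow> \<exists>v\<in>T. g v \<noteq> v"
  using G_not_in[of g] by (auto simp: one_G fun_eq_iff)

text \<open>The level stabilizer is the product of the copies of W at the vertices of that level.
  \<open>N\<close> varies in the induction, which is applied to the preimage of \<open>N\<close>
  under \<open>below x\<close>.\<close>

lemma level_stabilizer_generated:
  "subgroup N G \<Longrightarrow> (\<And>v a. v \<in> T \<Longrightarrow> length v = n \<Longrightarrow> a \<in> carrier G \<Longrightarrow> below_vertex v a \<in> N) \<Longrightarrow>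
    g \<in> carrier G \<Longrightarrow> agree d n g \<one>\<^bsub>G\<^esub> \<Longrightarrow> g \<in> N"
proof (induction n arbitrary: N g)
  case 0
  thus ?case using "0.prems"(2)[of "[]" g] by simp
next
  case (Suc n)
  from node_cases[OF Suc.prems(3)] obtain p f
    where g: "p \<in> P" "\<And>x. f x \<in> carrier G" "g = node d p f" by metis
  have "agree d (Suc n) (node d p f) (node d id (\<lambda>_. id))" using Suc.prems(4) g by (simp add: node_one)
  hence p: "p = id" and f: "\<And>x. x \<in> {1..d} \<Longrightarrow> agree d n (f x) \<one>\<^bsub>G\<^esub>"
    using agree_Suc_node[OF g(1) id_P] by (auto simp: one_G)
  have "below x (f x) \<in> N" if x: "x \<in> {1..d}" for x
  proof -
    let ?N = "{a \<in> carrier G. below x a \<in> N}"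
    have "subgroup ?N G"
      by (rule G.subgroupI)
        (use Suc.prems(1) in \<open>auto simp: below_mult below_inv subgroup.m_closed subgroup.m_inv_closed
          subgroup.one_closed intro!: exI[of _ "\<one>\<^bsub>G\<^esub>"]\<close>)
    moreover have "below_vertex v a \<in> ?N" if "v \<in> T" "length v = n" "a \<in> carrier G" for v a
      using Suc.prems(2)[of "x # v" a] that x by simp
    ultimately have "f x \<in> ?N" using Suc.IH[of ?N "f x"] g(2) f[OF x] by blast
    thus ?thesis by simp
  qed
  hence "below_list (map (\<lambda>x. (x, f x)) [1..<Suc d]) \<in> N"
    by (intro below_list_subgroup[OF Suc.prems(1)]) auto
  thus ?case using g p node_below_list[of f] by simp
qed

lemma finite_index_of_level:
  assumes N: "subgroup N G" and n: "\<forall>g\<in>carrier G. agree d n g \<one>\<^bsub>G\<^esub> \<longrightarrow> g \<in> N"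
  shows "finite (rcosets\<^bsub>G\<^esub> N)"
proof (rule G.finite_rcosets_if_finite_invariant[OF N])
  let ?L = "{v \<in> T. length v = n}"
  let ?F = "\<lambda>g. restrict (inv\<^bsub>G\<^esub> g) ?L"
  have "(inv\<^bsub>G\<^esub> g) v \<in> ?L" if "g \<in> carrier G" "v \<in> ?L" for g v
    using that G_mem[of "inv\<^bsub>G\<^esub> g" v] G_length[of "inv\<^bsub>G\<^esub> g" v] by simp
  hence "?F g \<in> ?L \<rightarrow>\<^sub>E ?L" if "g \<in> carrier G" for g
    unfolding restrict_PiE_iff using that by blast
  hence "?F ` carrier G \<subseteq> ?L \<rightarrow>\<^sub>E ?L" by (rule image_subsetI)
  thus "finite (?F ` carrier G)" by (rule finite_subset) (simp add: finite_PiE finite_level)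
  fix g h assume g: "g \<in> carrier G" and h: "h \<in> carrier G" and eq: "?F g = ?F h"
  have "g ((inv\<^bsub>G\<^esub> h) v) = v" if "v \<in> ?L" for v
  proof -
    have "(inv\<^bsub>G\<^esub> h) v = (inv\<^bsub>G\<^esub> g) v" using fun_cong[OF eq, of v] that by (simp only: restrict_apply if_True)
    thus ?thesis using inv_G_cancel(1)[OF g, of v] by simp
  qed
  hence "agree d n (g \<otimes>\<^bsub>G\<^esub> inv\<^bsub>G\<^esub> h) \<one>\<^bsub>G\<^esub>" by (simp add: agree_def mult_G one_G)
  thus "g \<otimes>\<^bsub>G\<^esub> inv\<^bsub>G\<^esub> h \<in> N" using n g h by simp
qed

text \<open>\<open>below 1\<close> is injective but misses a rooted element that moves the letter 1;
  on a finite carrier it would be onto.\<close>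

lemma infinite_carrier: "infinite (carrier G)"
proof
  assume fin: "finite (carrier G)"
  have "inj_on (below 1) (carrier G)"
  proof (rule inj_onI)
    fix a b assume a: "a \<in> carrier G" and b: "b \<in> carrier G" and eq: "below 1 a = below 1 b"
    have "sec d (below 1 c) 1 = c" if "c \<in> carrier G" for c
      unfolding below_def by (subst sec_node[of _ 1]) (use that d2 in auto)
    thus "a = b" using a b eq by metis
  qed
  hence "below 1 ` carrier G = carrier G" by (intro endo_inj_surj fin) auto
  moreover obtain t where t: "t \<in> P" "t 1 = 2" using trans d2 unfolding transitive_perms_def by force
  ultimately obtain a where "rooted t = below 1 a" using rooted_closed by blast
  hence "t = id"
    using root_node[OF t(1)] root_node[OF id_P] by (metis rooted_def below_def)
  thus False using t by simp
qed

lemma commutator_node_id: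
  assumes f: "\<And>x. x \<in> {1..d} \<Longrightarrow> f x \<in> carrier G" and h: "\<And>x. x \<in> {1..d} \<Longrightarrow> h x \<in> carrier G"
  shows "commutator G (node d id f) (node d id h) = node d id (\<lambda>x. commutator G (f x) (h x))"
proof -
  have mult: "node d id a \<otimes>\<^bsub>G\<^esub> node d id b = node d id (\<lambda>x. a x \<otimes>\<^bsub>G\<^esub> b x)"
    if "\<And>x. x \<in> {1..d} \<Longrightarrow> b x \<in> carrier G" for a b
    using node_mult[of id b id a] that by simp
  have inv: "inv\<^bsub>G\<^esub> (node d id a) = node d id (\<lambda>x. inv\<^bsub>G\<^esub> (a x))"
    if a: "\<And>x. x \<in> {1..d} \<Longrightarrow> a x \<in> carrier G" for a
  proof (rule G.inv_equality)
    have "node d id (\<lambda>x. inv\<^bsub>G\<^esub> (a x)) \<otimes>\<^bsub>G\<^esub> node d id a = node d id (\<lambda>_. id)"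
      by (subst mult[OF a]) (auto intro!: node_cong simp: a one_G[symmetric])
    thus "node d id (\<lambda>x. inv\<^bsub>G\<^esub> (a x)) \<otimes>\<^bsub>G\<^esub> node d id a = \<one>\<^bsub>G\<^esub>" by (simp only: node_one)
  qed (auto intro!: node_closed simp: a)
  show ?thesis unfolding commutator_def
    by (simp only: inv[of f, OF f] inv[of h, OF h] mult f h G.inv_closed)
qed

lemma derived_setD:
  assumes "h \<in> derived_set (sym_group d) P"
  shows "\<exists>p\<in>P. \<exists>q\<in>P. h = p \<circ> q \<circ> inv' p \<circ> inv' q"
proof -
  from assms obtain p q where pq: "p \<in> P" "q \<in> P"
    and h: "h = p \<otimes>\<^bsub>sym_group d\<^esub> q \<otimes>\<^bsub>sym_group d\<^esub> inv\<^bsub>sym_group d\<^esub> p \<otimes>\<^bsub>sym_group d\<^esub> inv\<^bsub>sym_group d\<^esub> q"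
    by blast
  have "h = p \<circ> q \<circ> inv' p \<circ> inv' q"
    unfolding h sym_group_mult sym_group_inv_equality[OF subgroup.mem_carrier[OF P pq(1)]]
      sym_group_inv_equality[OF subgroup.mem_carrier[OF P pq(2)]] ..
  thus ?thesis using pq by blast
qed

text \<open>A self-similarity criterion: as each \<open>below x\<close> is a homomorphism, the
  condition on \<open>S\<close> passes to the generated subgroup, which can then imitate any element
  to any depth, branch by branch.\<close>

lemma generate_dense:
  assumes S: "S \<subseteq> carrier G" and root: "rooted ` P \<subseteq> S"
    and below: "\<And>s x. s \<in> S \<Longrightarrow> x \<in> {1..d} \<Longrightarrow> below x s \<in> generate G S"
  shows "(wreath_topology d P) closure_of (generate G S) = carrier G"
proof -
  have sub: "subgroup (generate G S) G" by (rule G.generate_is_subgroup[OF S])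
  have gen: "g \<in> carrier G" if "g \<in> generate G S" for g
    using subgroup.mem_carrier[OF sub that] .
  have below_gen: "below x g \<in> generate G S" if "g \<in> generate G S" "x \<in> {1..d}" for x g
    using that
  proof (induction rule: generate.induct)
    case one
    thus ?case by (simp add: generate.one)
  next
    case (incl h)
    thus ?case using below by blast
  next
    case (inv h)
    thus ?case using below[of h x] S below_inv subgroup.m_inv_closed[OF sub] by auto
  next
    case (eng h1 h2)
    thus ?case using gen below_mult subgroup.m_closed[OF sub] by simp
  qed
  have dense: "g \<in> carrier G \<Longrightarrow> \<exists>h\<in>generate G S. agree d n g h" for g n
  proof (induction n arbitrary: g)
    case 0
    show ?case by (intro bexI[OF agree_0 generate.one] 0) simp
  next
    case (Suc n)
    from node_cases[OF Suc.prems] obtain q f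
      where g: "q \<in> P" "\<And>x. f x \<in> carrier G" "g = node d q f" by metis
    have gb: "g = node d id (\<lambda>x. f (inv' q x)) \<otimes>\<^bsub>G\<^esub> rooted q"
      unfolding g(3) by (rule node_decomp) (use g in auto)
    have "\<forall>x. \<exists>h\<in>generate G S. agree d n (f (inv' q x)) h" using Suc.IH g(2) by blast
    then obtain h where h: "\<And>x. h x \<in> generate G S" "\<And>x. agree d n (f (inv' q x)) (h x)" by metis
    have "below_list (map (\<lambda>x. (x, h x)) [1..<Suc d]) \<in> generate G S"
      by (rule below_list_subgroup[OF sub]) (use h below_gen in auto)
    hence "node d id h \<in> generate G S" using node_below_list[of h] h gen by simp
    moreover have "rooted q \<in> generate G S" using root g by (auto intro: generate.incl)
    moreover have "agree d (Suc n) g (node d id h \<otimes>\<^bsub>G\<^esub> rooted q)"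
      unfolding gb by (intro agree_mult) (use g h gen in \<open>simp_all add: agree_Suc_node node_closed\<close>)
    ultimately show ?case by (intro bexI[OF _ generate.eng])
  qed
  show ?thesis
  proof
    show "(wreath_topology d P) closure_of (generate G S) \<subseteq> carrier G"
      using closure_of_subset_topspace[of "wreath_topology d P" "generate G S"] by (simp add: carrier_G)
    show "carrier G \<subseteq> (wreath_topology d P) closure_of (generate G S)"
    proof
      fix g assume g: "g \<in> carrier G"
      have "\<exists>h\<in>generate G S. h \<in> U" if U: "g \<in> U" "openin (wreath_topology d P) U" for U
      proof -
        obtain n where "\<forall>h\<in>carrier G. agree d n g h \<longrightarrow> h \<in> U"
          using U unfolding openin_wreath_topology by blast
        thus ?thesis using dense[OF g, of n] gen by blast
      qed
      thus "g \<in> (wreath_topology d P) closure_of (generate G S)"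
        unfolding in_closure_of topspace_wreath_topology using g unfolding carrier_G by blast
    qed
  qed
qed

end

section \<open>Consequences of perfectness\<close>

locale perfect_wreath = wreath +
  assumes perfect: "derived (sym_group d) P = P"
begin

lemma root_group_comm_prods:
  "\<exists>k. P \<subseteq> comm_prods (sym_group d\<lparr>carrier := P\<rparr>) k"
proof -
  interpret S: group "sym_group d\<lparr>carrier := P\<rparr>"
    using group.subgroup_imp_group[OF sym_group_is_group P] .
  have "derived (sym_group d\<lparr>carrier := P\<rparr>) P = P"
    using group.derived_consistent[OF sym_group_is_group _ P, of P] perfect by simp
  thus ?thesis using S.finite_perfect_comm_prods finite_P by simp
qed

lemma carrier_comm_prods: "\<exists>m. carrier G \<subseteq> comm_prods G m"
proof -
  obtain k where k: "P \<subseteq> comm_prods (sym_group d\<lparr>carrier := P\<rparr>) k"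
    using root_group_comm_prods by blast
  have "rooted ` P \<subseteq> comm_prods G k"
    using group_hom.comm_prods_image[OF rooted_hom] k by blast
  from comm_prods_approx[OF this refl] comm_prods_complete show ?thesis by blast
qed

text \<open>On two letters a transitive \<open>P\<close> contains the transposition, whose sign is
  -1. The directed generators will use the third letter.\<close>

lemma d3: "d \<ge> 3"
proof (rule ccontr)
  assume "\<not> d \<ge> 3"
  hence d: "d = 2" using d2 by simp
  obtain p where p: "p \<in> P" "p 1 = 2" using trans d unfolding transitive_perms_def by force
  have "p = Transposition.transpose 1 2"
  proof
    fix x show "p x = Transposition.transpose 1 2 x"
    proof (cases "x \<in> {1..2}")
      case True
      hence "x = 1 \<or> x = 2" by auto
      moreover have "p 2 = 1"
        using P_mem[OF p(1), of 2] P_eq_iff[OF p(1), of 1 2] p(2) d by (auto simp: le_Suc_eq numeral_2_eq_2)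
      ultimately show ?thesis using p by (auto simp: Transposition.transpose_def)
    next
      case False
      thus ?thesis using permutes_not_in[OF P_permutes[OF p(1)], of x] d by (auto simp: Transposition.transpose_def)
    qed
  qed
  hence "sign p = (-1 :: int)" by (simp add: sign_swap_id)
  thus False using sign_of_perfect[OF subgroup.subset[OF P] perfect p(1)] by simp
qed

text \<open>Here the abstract perfectness of W enters. \<open>N\<close> may fail to be closed, but
  every \<open>a\<close> is an actual finite product of commutators, so no limit is taken.\<close>

lemma subgroup_below_vertex:
  assumes N: "subgroup N G"
    and comm: "\<And>a b. a \<in> carrier G \<Longrightarrow> b \<in> carrier G \<Longrightarrow> below_vertex v (commutator G a b) \<in> N"
    and a: "a \<in> carrier G"
  shows "below_vertex v a \<in> N"
proof -
  interpret h: group_hom G G "below_vertex v" using below_vertex_hom by unfold_locales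
  have "below_vertex v c \<in> N" if "c \<in> comm_prods G m" for c m
    using that
  proof (induction m arbitrary: c)
    case 0
    thus ?case using subgroup.one_closed[OF N] by simp
  next
    case (Suc m)
    then obtain x y e where *: "c = commutator G x y \<otimes>\<^bsub>G\<^esub> e" "x \<in> carrier G" "y \<in> carrier G"
      "e \<in> comm_prods G m" by auto
    thus ?case
      using Suc.IH[OF *(4)] comm[OF *(2,3)] subgroup.m_closed[OF N] G.comm_prods_closed[OF *(4)]
      by simp
  qed
  thus ?thesis using carrier_comm_prods a by blast
qed

text \<open>A double commutator isolates one branch. Commuting \<open>g\<close> with an element
  below \<open>v\<close> gives a part below \<open>g v\<close> times a part below \<open>v\<close>;
  commuting with a second element below \<open>v\<close> removes the part below \<open>g v\<close>,
  since the copies at distinct vertices of one level commute. An arbitrary commutator in the copy at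
  \<open>v\<close> remains.\<close>

lemma normal_contains_level_stabilizer:
  assumes N: "N \<lhd> G" and nontriv: "N \<noteq> {\<one>\<^bsub>G\<^esub>}"
  shows "\<exists>n. \<forall>g\<in>carrier G. agree d n g \<one>\<^bsub>G\<^esub> \<longrightarrow> g \<in> N"
proof -
  interpret N: normal N G by (rule N)
  obtain g where g: "g \<in> N" "g \<noteq> \<one>\<^bsub>G\<^esub>" using nontriv N.one_closed by blast
  have gc: "g \<in> carrier G" using g by simp
  from exists_nontrivial_move[OF gc g(2)] obtain v where v: "v \<in> T" "g v \<noteq> v" by blast
  interpret h: group_hom G G "below_vertex v" using below_vertex_hom by unfold_locales
  have conjN: "x \<otimes>\<^bsub>G\<^esub> y \<otimes>\<^bsub>G\<^esub> inv\<^bsub>G\<^esub> x \<in> N" if "x \<in> carrier G" "y \<in> N" for x y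
    using that N.inv_op_closed2 by simp
  have commN: "commutator G y x \<in> N" if "x \<in> carrier G" "y \<in> N" for x y
  proof -
    have "commutator G y x = y \<otimes>\<^bsub>G\<^esub> (x \<otimes>\<^bsub>G\<^esub> inv\<^bsub>G\<^esub> y \<otimes>\<^bsub>G\<^esub> inv\<^bsub>G\<^esub> x)"
      using that by (simp add: commutator_def G.m_assoc)
    thus ?thesis using conjN[of x "inv\<^bsub>G\<^esub> y"] that by simp
  qed
  have "below_vertex v (commutator G a b) \<in> N" if a: "a \<in> carrier G" and b: "b \<in> carrier G" for a b
  proof -
    \<comment> \<open>The inverse is taken because \<open>commutator G g ?a\<close> ends with the
      inverse of \<open>?a\<close>, which is then \<open>below_vertex v a\<close>.\<close>
    let ?a = "below_vertex v (inv\<^bsub>G\<^esub> a)" and ?b = "below_vertex v b"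
    obtain a' where a': "a' \<in> carrier G"
      "g \<otimes>\<^bsub>G\<^esub> ?a = below_vertex (g v) a' \<otimes>\<^bsub>G\<^esub> g"
      using below_vertex_conj[OF gc v(1), of "inv\<^bsub>G\<^esub> a"] a by auto
    let ?u = "below_vertex (g v) a'" and ?c = "below_vertex v a"
    have com: "?u \<otimes>\<^bsub>G\<^esub> below_vertex v z = below_vertex v z \<otimes>\<^bsub>G\<^esub> ?u" if "z \<in> carrier G" for z
      using below_vertex_commute[OF v(2) _ a'(1) that] G_length[OF gc] by simp
    have "commutator G g ?a = ?u \<otimes>\<^bsub>G\<^esub> ?c"
      using a a' gc by (simp add: commutator_def G.m_assoc)
    hence uN: "?u \<otimes>\<^bsub>G\<^esub> ?c \<in> N" using commN[of ?a g] g a by simp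
    have "commutator G (?u \<otimes>\<^bsub>G\<^esub> ?c) ?b = ?u \<otimes>\<^bsub>G\<^esub> commutator G ?c ?b \<otimes>\<^bsub>G\<^esub> inv\<^bsub>G\<^esub> ?u"
    proof -
      have "commutator G (?u \<otimes>\<^bsub>G\<^esub> ?c) ?b =
          ?u \<otimes>\<^bsub>G\<^esub> (?c \<otimes>\<^bsub>G\<^esub> ?b \<otimes>\<^bsub>G\<^esub> inv\<^bsub>G\<^esub> ?c) \<otimes>\<^bsub>G\<^esub> (inv\<^bsub>G\<^esub> ?u \<otimes>\<^bsub>G\<^esub> inv\<^bsub>G\<^esub> ?b)"
        using a b a' by (simp add: commutator_def G.m_assoc G.inv_mult_group)
      also have "inv\<^bsub>G\<^esub> ?u \<otimes>\<^bsub>G\<^esub> inv\<^bsub>G\<^esub> ?b = inv\<^bsub>G\<^esub> ?b \<otimes>\<^bsub>G\<^esub> inv\<^bsub>G\<^esub> ?u"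
        using com[OF b] a' b by (simp add: G.inv_mult_group[symmetric])
      finally show ?thesis using a b a' by (simp add: commutator_def G.m_assoc)
    qed
    also have "\<dots> = commutator G ?c ?b"
      using com[of "commutator G a b"] a b a' h.commutator_image[OF a b] by (simp add: G.m_assoc)
    finally show ?thesis using commN[OF _ uN, of ?b] b h.commutator_image[OF a b] by simp
  qed
  hence vN: "below_vertex v a \<in> N" if "a \<in> carrier G" for a
    using subgroup_below_vertex[OF N.subgroup_axioms] that by blast
  \<comment> \<open>Conjugation by an element that takes \<open>u\<close> to \<open>v\<close>
    spreads the containment from \<open>v\<close> to its whole level.\<close>
  have "below_vertex u a \<in> N" if u: "u \<in> T" "length u = length v" and a: "a \<in> carrier G" for u a
  proof -
    obtain t where t: "t \<in> carrier G" "t u = v" using level_transitive[OF u(1) v(1) u(2)] by blast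
    from below_vertex_conj[OF t(1) u(1) a] t obtain b where b: "b \<in> carrier G"
      "t \<otimes>\<^bsub>G\<^esub> below_vertex u a = below_vertex v b \<otimes>\<^bsub>G\<^esub> t" by auto
    have "inv\<^bsub>G\<^esub> t \<otimes>\<^bsub>G\<^esub> below_vertex v b \<otimes>\<^bsub>G\<^esub> t = below_vertex u a"
      using a b(1) t by (simp add: G.m_assoc b(2)[symmetric] G.mult_inv_cancel_left)
    thus ?thesis using N.inv_op_closed1[OF t(1) vN[OF b(1)]] by metis
  qed
  thus ?thesis using level_stabilizer_generated[OF N.subgroup_axioms] by blast
qed

lemma perfect_just_infinite: "just_infinite G (wreath_topology d P)"
  unfolding just_infinite_def
proof (intro conjI allI impI infinite_carrier)
  fix N assume N: "N \<lhd> G \<and> closedin (wreath_topology d P) N \<and> N \<noteq> {\<one>\<^bsub>G\<^esub>}"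
  thus "finite (rcosets\<^bsub>G\<^esub> N)"
    using normal_contains_level_stabilizer finite_index_of_level normal_imp_subgroup by blast
qed

lemma perfect_strongly_complete: "strongly_complete G (wreath_topology d P)"
  unfolding strongly_complete_def
proof (intro allI impI)
  fix H assume H: "subgroup H G \<and> finite (rcosets\<^bsub>G\<^esub> H)"
  then obtain N where N: "N \<lhd> G" "N \<noteq> {\<one>\<^bsub>G\<^esub>}" "N \<subseteq> H"
    using G.normal_core_of_finite_index[OF infinite_carrier] by blast
  obtain n where n: "\<And>g. g \<in> carrier G \<Longrightarrow> agree d n g \<one>\<^bsub>G\<^esub> \<Longrightarrow> g \<in> N"
    using normal_contains_level_stabilizer[OF N(1,2)] by blast
  have sub: "H \<subseteq> carrier G" using H subgroup.subset by blast
  have "h \<in> H" if g: "g \<in> H" and h: "h \<in> carrier G" "agree d n g h" for g h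
  proof -
    have gc: "g \<in> carrier G" using g sub by blast
    have "agree d n (inv\<^bsub>G\<^esub> g \<otimes>\<^bsub>G\<^esub> h) (inv\<^bsub>G\<^esub> g \<otimes>\<^bsub>G\<^esub> g)"
      by (rule agree_mult[OF _ gc agree_refl agree_sym[OF h(2)]]) (use gc in simp)
    hence "agree d n (inv\<^bsub>G\<^esub> g \<otimes>\<^bsub>G\<^esub> h) \<one>\<^bsub>G\<^esub>" using gc by simp
    hence "inv\<^bsub>G\<^esub> g \<otimes>\<^bsub>G\<^esub> h \<in> H" using n N(3) gc h(1) by blast
    hence "g \<otimes>\<^bsub>G\<^esub> (inv\<^bsub>G\<^esub> g \<otimes>\<^bsub>G\<^esub> h) \<in> H" using H g subgroup.m_closed by metis
    thus ?thesis using gc h by (simp add: G.mult_inv_cancel_left)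
  qed
  thus "openin (wreath_topology d P) H" unfolding openin_wreath_topology using sub by blast
qed

text \<open>Besides the rooted elements there are two directed families, both acting by \<open>p\<close> below the
  letter 2 but recursing below the letters 1 and 3 respectively, so that a commutator of one element
  of each family is concentrated below the letter 2.\<close>

lemma perfect_topologically_finitely_generated:
  "topologically_finitely_generated G (wreath_topology d P)"
proof -
  define s where "s = (\<lambda>x p. SOME s. s \<in> carrier G \<and>
    s = node d id (\<lambda>z. if z = x then s else if z = 2 then rooted p else id))"
  have s_prop: "s x p \<in> carrier G \<and>
      s x p = node d id (\<lambda>z. if z = x then s x p else if z = 2 then rooted p else id)"
    if p: "p \<in> P" for x p
  proof -
    have "\<exists>s\<in>carrier G. s = node d id (\<lambda>z. if z = x then s else if z = 2 then rooted p else id)"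
      by (rule directed_element) (use p in auto)
    thus ?thesis unfolding s_def Bex_def by (rule someI_ex)
  qed
  note s = s_prop[THEN conjunct1] and s_eq = s_prop[THEN conjunct2]
  define S where "S = rooted ` P \<union> s 1 ` P \<union> s 3 ` P"
  have S: "S \<subseteq> carrier G" using s by (auto simp: S_def)
  have fin: "finite S" using finite_P by (simp add: S_def)
  have sub: "subgroup (generate G S) G" by (rule G.generate_is_subgroup[OF S])
  note mult = subgroup.m_closed[OF sub] and inv = subgroup.m_inv_closed[OF sub]
  have gen: "rooted p \<in> generate G S" "s 1 p \<in> generate G S" "s 3 p \<in> generate G S" if "p \<in> P" for p
    using that by (auto simp: S_def intro: generate.incl)
  \<comment> \<open>By transitivity it is enough to find, for each generator, one letter below which
    its copy is generated.\<close>
  have move: "below y a \<in> generate G S"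
    if x: "x \<in> {1..d}" "y \<in> {1..d}" and a: "a \<in> carrier G" "below x a \<in> generate G S" for x y a
  proof -
    obtain t where t: "t \<in> P" "t x = y" using trans x unfolding transitive_perms_def by blast
    have "rooted t \<otimes>\<^bsub>G\<^esub> below x a \<otimes>\<^bsub>G\<^esub> inv\<^bsub>G\<^esub> (rooted t) \<in> generate G S"
      using gen(1)[OF t(1)] a(2) mult inv by blast
    thus ?thesis using rooted_below_conj[OF t(1) a(1), of x] t(2) by simp
  qed
  have comm: "below 2 (rooted (p \<circ> q \<circ> inv' p \<circ> inv' q)) \<in> generate G S" if p: "p \<in> P" and q: "q \<in> P" for p q
  proof -
    have r: "rooted (p \<circ> q \<circ> inv' p \<circ> inv' q) = commutator G (rooted p) (rooted q)"
    proof -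
      interpret R: group_hom "sym_group d\<lparr>carrier := P\<rparr>" G rooted by (rule rooted_hom)
      have "commutator (sym_group d\<lparr>carrier := P\<rparr>) p q = p \<circ> q \<circ> inv' p \<circ> inv' q"
        using p q group.m_inv_consistent[OF sym_group_is_group P] subgroup.mem_carrier[OF P]
        by (simp add: commutator_def sym_group_mult)
      thus ?thesis using R.commutator_image[of p q] p q by simp
    qed
    have triv: "commutator G a id = id" "commutator G id a = id" if "a \<in> carrier G" for a
      using that by (simp_all add: commutator_def one_G[symmetric] del: id_apply)
    have "commutator G (s 1 p) (s 3 q) = node d id (\<lambda>z. commutator G
        (if z = 1 then s 1 p else if z = 2 then rooted p else id)
        (if z = 3 then s 3 q else if z = 2 then rooted q else id))"
      using p q s s_eq[OF p, of 1] s_eq[OF q, of 3]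
        commutator_node_id[of "\<lambda>z. if z = 1 then s 1 p else if z = 2 then rooted p else id"
          "\<lambda>z. if z = 3 then s 3 q else if z = 2 then rooted q else id"]
      by (simp del: One_nat_def)
    \<comment> \<open>At the letters 1 and 3 one of the two entries is \<open>id\<close>; at every
      other letter except 2 both are.\<close>
    also have "\<dots> = below 2 (commutator G (rooted p) (rooted q))"
      unfolding below_def using s[OF p] s[OF q] p q by (intro node_cong) (auto simp: triv)
    finally have "below 2 (rooted (p \<circ> q \<circ> inv' p \<circ> inv' q)) = commutator G (s 1 p) (s 3 q)" using r by simp
    also have "\<dots> \<in> generate G S"
      unfolding commutator_def using gen(2)[OF p] gen(3)[OF q] mult inv by blast
    finally show ?thesis .
  qed
  \<comment> \<open>Commutators of elements of \<open>P\<close> are covered by \<open>comm\<close>;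
    since \<open>P\<close> is generated by them, the claim extends to all of
    \<open>P\<close>.\<close>
  have b2: "below 2 (rooted p) \<in> generate G S" if p: "p \<in> P" for p
  proof -
    have inP: "q \<in> P" if "q \<in> generate (sym_group d) (derived_set (sym_group d) P)" for q
      using that perfect by (simp add: derived_def)
    have "p \<in> generate (sym_group d) (derived_set (sym_group d) P)"
      using p perfect by (simp add: derived_def)
    thus ?thesis
    proof (induction rule: generate.induct)
      case one
      have "below 2 (rooted id) = \<one>\<^bsub>G\<^esub>" unfolding rooted_def by (simp only: node_one below_one)
      thus ?case using generate.one[of G S] by (simp only: sym_group_one)
    next
      case (incl h)
      from derived_setD[OF incl] obtain p q
        where pq: "p \<in> P" "q \<in> P" "h = p \<circ> q \<circ> inv' p \<circ> inv' q" by (elim bexE)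
      show ?case unfolding pq(3) by (rule comm[OF pq(1,2)])
    next
      case (inv h)
      from derived_setD[OF inv] obtain p q
        where pq: "p \<in> P" "q \<in> P" "h = p \<circ> q \<circ> inv' p \<circ> inv' q" by (elim bexE)
      interpret R: group_hom "sym_group d\<lparr>carrier := P\<rparr>" G rooted by (rule rooted_hom)
      have h: "h \<in> P" using pq by (simp add: inv_P)
      have "below 2 (rooted (inv\<^bsub>sym_group d\<^esub> h)) = inv\<^bsub>G\<^esub> (below 2 (rooted h))"
        using R.hom_inv[of h] h group.m_inv_consistent[OF sym_group_is_group P h]
        by (simp add: below_inv)
      thus ?case using comm[OF pq(1,2)] pq(3) subgroup.m_inv_closed[OF sub] by simp
    next
      case (eng h1 h2)
      note h = inP[OF eng(1)] inP[OF eng(2)]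
      have "below 2 (rooted (h1 \<otimes>\<^bsub>sym_group d\<^esub> h2)) = below 2 (rooted h1) \<otimes>\<^bsub>G\<^esub> below 2 (rooted h2)"
        unfolding sym_group_mult rooted_mult[OF h(2), symmetric] by (rule below_mult) (simp_all add: h)
      thus ?case using mult[OF eng.IH] by metis
    qed
  qed
  have two: "2 \<in> {1..d}" using d3 by simp
  have dir: "below x (s x p) \<in> generate G S" if p: "p \<in> P" and x: "x = 1 \<or> x = 3" for x p
  proof -
    \<comment> \<open>\<open>s x p\<close> differs from its own copy below \<open>x\<close> only by
      a factor below 2 that is already generated, so the copy is generated too.\<close>
    have "below x (s x p) \<otimes>\<^bsub>G\<^esub> below 2 (rooted p) = s x p"
      using x by (subst (2) s_eq[OF p], unfold below_def, subst node_mult)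
        (auto simp: p mult_G intro!: node_cong)
    hence "below x (s x p) = s x p \<otimes>\<^bsub>G\<^esub> inv\<^bsub>G\<^esub> (below 2 (rooted p))"
      using s[OF p] p by (metis G.inv_solve_right below_closed rooted_closed)
    moreover have "s x p \<in> generate G S" using gen[OF p] x by auto
    ultimately show ?thesis using mult inv b2[OF p] by simp
  qed
  have "below y a \<in> generate G S" if a: "a \<in> S" and y: "y \<in> {1..d}" for a y
  proof -
    obtain x where "x \<in> {1..d}" "below x a \<in> generate G S"
    proof -
      consider p where "p \<in> P" "a = rooted p" | p where "p \<in> P" "a = s 1 p" | p where "p \<in> P" "a = s 3 p"
        using a by (auto simp: S_def)
      thus ?thesis
      proof cases
        case 1
        thus ?thesis using that[OF two] b2 by blast
      next
        case 2
        thus ?thesis using that[of 1] dir[of p 1] d3 by simp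
      next
        case 3
        thus ?thesis using that[of 3] dir[of p 3] d3 by simp
      qed
    qed
    thus ?thesis using move[OF _ y] a S by blast
  qed
  hence "(wreath_topology d P) closure_of (generate G S) = carrier G"
    by (intro generate_dense S) (auto simp: S_def)
  thus ?thesis unfolding topologically_finitely_generated_def
    unfolding topspace_wreath_topology using fin S by (intro exI[of _ S]) (simp add: carrier_G)
qed

end

subsection \<open>Imperfect labels\<close>

text \<open>\<open>A\<close> will be the quotient of \<open>P\<close> by its commutator subgroup,
  \<theta> the projection and \<open>p0\<close> any element outside that subgroup. The arguments see
  only a finite commutative target and one non-trivial value.\<close>

locale wreath_character = wreath + A: comm_group A
  for A :: "'c monoid" (structure) +
  fixes \<theta> :: "(nat \<Rightarrow> nat) \<Rightarrow> 'c" and p0 :: "nat \<Rightarrow> nat"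
  assumes finite_A: "finite (carrier A)"
    and \<theta>_closed: "\<And>p. p \<in> P \<Longrightarrow> \<theta> p \<in> carrier A"
    and \<theta>_mult: "\<And>p q. p \<in> P \<Longrightarrow> q \<in> P \<Longrightarrow> \<theta> (p \<circ> q) = \<theta> p \<otimes> \<theta> q"
    and p0: "p0 \<in> P" and \<theta>_p0: "\<theta> p0 \<noteq> \<one>"
begin

text \<open>Unfolding the recursion, this is the product of the values of \<open>\<theta>\<close> at all labels of one level.\<close>

primrec level_char :: "nat \<Rightarrow> (nat list \<Rightarrow> nat list) \<Rightarrow> 'c" where
  "level_char 0 g = \<theta> (first_level_perm d g)"
| "level_char (Suc n) g = finprod A (\<lambda>x. level_char n (sec d g x)) {1..d}"

lemma \<theta>_id: "\<theta> id = \<one>"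
proof -
  have "\<theta> id \<otimes> \<theta> id = \<theta> id" using \<theta>_mult[of id id] by simp
  thus ?thesis using A.l_cancel_one[of "\<theta> id" "\<theta> id"] \<theta>_closed[of id] by simp
qed

lemma level_char_closed: "g \<in> carrier G \<Longrightarrow> level_char n g \<in> carrier A"
proof (induction n arbitrary: g)
  case 0
  thus ?case using \<theta>_closed node_eta(1) by simp
next
  case (Suc n)
  thus ?case using node_eta(2) by (auto intro!: A.finprod_closed)
qed

lemma level_char_0_node: "p \<in> P \<Longrightarrow> level_char 0 (node d p f) = \<theta> p"
  by (simp add: root_node)

lemma level_char_Suc_node:
  assumes "\<And>x. x \<in> {1..d} \<Longrightarrow> f x \<in> carrier G"
  shows "level_char (Suc n) (node d p f) = finprod A (\<lambda>x. level_char n (f x)) {1..d}"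
  unfolding level_char.simps
  by (rule A.finprod_cong') (use assms level_char_closed in \<open>auto simp: sec_node\<close>)

text \<open>In a product the sections of the left factor are permuted by the root permutation
  \<open>q\<close> of the right one; in commutative \<open>A\<close> the reordered product over all
  letters has the same value.\<close>

lemma level_char_mult:
  "g \<in> carrier G \<Longrightarrow> h \<in> carrier G \<Longrightarrow>
    level_char n (g \<otimes>\<^bsub>G\<^esub> h) = level_char n g \<otimes> level_char n h"
proof (induction n arbitrary: g h)
  case 0
  obtain p f where g: "p \<in> P" "\<And>x. f x \<in> carrier G" "g = node d p f" using node_cases[OF 0(1)] by metis
  obtain q e where h: "q \<in> P" "\<And>x. e x \<in> carrier G" "h = node d q e" using node_cases[OF 0(2)] by metis
  show ?case using g h by (simp add: node_mult root_node \<theta>_mult)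
next
  case (Suc n)
  obtain p f where g: "p \<in> P" "\<And>x. f x \<in> carrier G" "g = node d p f"
    using node_cases[OF Suc.prems(1)] by metis
  obtain q e where h: "q \<in> P" "\<And>x. e x \<in> carrier G" "h = node d q e"
    using node_cases[OF Suc.prems(2)] by metis
  note c = level_char_closed[OF g(2)] level_char_closed[OF h(2)]
  have "level_char (Suc n) (g \<otimes>\<^bsub>G\<^esub> h) = finprod A (\<lambda>x. level_char n (f (q x) \<otimes>\<^bsub>G\<^esub> e x)) {1..d}"
    unfolding g(3) h(3) node_mult[OF h(1,2)] by (rule level_char_Suc_node) (simp add: g h)
  also have "\<dots> = finprod A (\<lambda>x. level_char n (f (q x)) \<otimes> level_char n (e x)) {1..d}"
    by (rule A.finprod_cong') (use c Suc.IH g h in auto)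
  also have "\<dots> = finprod A (\<lambda>x. level_char n (f (q x))) {1..d} \<otimes> finprod A (\<lambda>x. level_char n (e x)) {1..d}"
    by (rule A.finprod_multf) (use c in auto)
  also have "finprod A (\<lambda>x. level_char n (f (q x))) {1..d} = finprod A (\<lambda>x. level_char n (f x)) (q ` {1..d})"
    by (rule A.finprod_reindex[symmetric]) (use c P_eq_iff[OF h(1)] in \<open>auto simp: inj_on_def\<close>)
  also have "q ` {1..d} = {1..d}" by (rule permutes_image[OF P_permutes[OF h(1)]])
  also have "finprod A (\<lambda>x. level_char n (f x)) {1..d} = level_char (Suc n) g"
    unfolding g(3) using g by (subst level_char_Suc_node) auto
  also have "finprod A (\<lambda>x. level_char n (e x)) {1..d} = level_char (Suc n) h"
    unfolding h(3) using h by (subst level_char_Suc_node) auto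
  finally show ?case .
qed

lemma level_char_hom: "group_hom G A (level_char n)"
  by unfold_locales (auto simp: hom_def level_char_closed level_char_mult)

lemma level_char_one: "level_char n \<one>\<^bsub>G\<^esub> = \<one>"
  using group_hom.hom_one[OF level_char_hom] .

text \<open>This is continuity. Labels on level \<open>n\<close> show in the action on level
  \<open>n + 1\<close>, hence the \<open>Suc\<close>.\<close>

lemma level_char_agree:
  "g \<in> carrier G \<Longrightarrow> h \<in> carrier G \<Longrightarrow> agree d (Suc n) g h \<Longrightarrow> level_char n g = level_char n h"
proof (induction n arbitrary: g h)
  case 0
  obtain p f where g: "p \<in> P" "\<And>x. f x \<in> carrier G" "g = node d p f" using node_cases[OF 0(1)] by metis
  obtain q e where h: "q \<in> P" "\<And>x. e x \<in> carrier G" "h = node d q e" using node_cases[OF 0(2)] by metis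
  show ?case using 0(3) g h agree_Suc_node[OF g(1) h(1)] by (simp add: root_node)
next
  case (Suc n)
  obtain p f where g: "p \<in> P" "\<And>x. f x \<in> carrier G" "g = node d p f"
    using node_cases[OF Suc.prems(1)] by metis
  obtain q e where h: "q \<in> P" "\<And>x. e x \<in> carrier G" "h = node d q e"
    using node_cases[OF Suc.prems(2)] by metis
  have "level_char n (f x) = level_char n (e x)" if "x \<in> {1..d}" for x
    using Suc.prems(3) g h agree_Suc_node[OF g(1) h(1)] that by (intro Suc.IH) auto
  hence "finprod A (\<lambda>x. level_char n (f x)) {1..d} = finprod A (\<lambda>x. level_char n (e x)) {1..d}"
    using level_char_closed h(2) by (intro A.finprod_cong') auto
  thus ?case unfolding g(3) h(3) using g(2) h(2)
    by (subst (1 2) level_char_Suc_node) auto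
qed

lemma level_char_Suc_below:
  assumes x: "x \<in> {1..d}" and a: "a \<in> carrier G"
  shows "level_char (Suc n) (below x a) = level_char n a"
proof -
  have "level_char (Suc n) (below x a) = finprod A (\<lambda>y. level_char n (if y = x then a else id)) {1..d}"
    unfolding below_def using a by (intro level_char_Suc_node) auto
  also have "\<dots> = finprod A (\<lambda>y. if y = x then level_char n a else \<one>) {1..d}"
    by (rule A.finprod_cong') (use a level_char_one level_char_closed in \<open>auto simp: one_G\<close>)
  also have "\<dots> = level_char n a"
    using A.finprod_singleton_swap[OF x, of "\<lambda>_. level_char n a"] a level_char_closed by simp
  finally show ?thesis .
qed

lemma level_char_0_below: "level_char 0 (below x a) = \<one>"
  unfolding below_def using level_char_0_node[OF id_P] \<theta>_id by simp

lemma level_char_rooted: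
  assumes p: "p \<in> P"
  shows "level_char n (rooted p) = (if n = 0 then \<theta> p else \<one>)"
proof (cases n)
  case 0
  thus ?thesis unfolding rooted_def using level_char_0_node[OF p] by simp
next
  case (Suc m)
  have "level_char (Suc m) (rooted p) = finprod A (\<lambda>x. level_char m id) {1..d}"
    unfolding rooted_def by (rule level_char_Suc_node) simp
  also have "\<dots> = \<one>" using level_char_one[of m] by (simp add: one_G)
  finally show ?thesis using Suc by simp
qed

text \<open>Moving an element down by \<open>length v\<close> levels shifts its sequence of
  characters by as many places and fills up with \<one>.\<close>

lemma level_char_below_vertex:
  assumes a: "a \<in> carrier G"
  shows "v \<in> T \<Longrightarrow> level_char n (below_vertex v a) =
    (if length v \<le> n then level_char (n - length v) a else \<one>)"
proof (induction v arbitrary: n)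
  case (Cons x v)
  thus ?case using a
    by (cases n) (simp_all add: level_char_Suc_below level_char_0_below del: level_char.simps)
qed simp

definition leftmost :: "nat \<Rightarrow> nat list" where
  "leftmost n = replicate n 1"

lemma leftmost: "leftmost n \<in> T" "length (leftmost n) = n"
  using d2 by (auto simp: leftmost_def tree_verts_def)

text \<open>The markers are dual to the characters: the only non-trivial label of
  \<open>marker n\<close> is \<open>p0\<close>, on level \<open>n\<close>. They separate the
  characters as well as the cosets of the common kernel.\<close>

definition marker :: "nat \<Rightarrow> nat list \<Rightarrow> nat list" where
  "marker n = below_vertex (leftmost n) (rooted p0)"

lemma marker_closed: "marker n \<in> carrier G"
  by (simp add: marker_def p0)

lemma level_char_marker: "level_char m (marker n) = (if m = n then \<theta> p0 else \<one>)"
  unfolding marker_def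
  by (auto simp: level_char_below_vertex level_char_rooted leftmost p0 simp del: level_char.simps)

section \<open>Failure of the three properties\<close>

lemma not_just_infinite: "\<not> just_infinite G (wreath_topology d P)"
proof
  assume J: "just_infinite G (wreath_topology d P)"
  define N where "N = {g \<in> carrier G. \<forall>n. level_char n g = \<one>}"
  have inv: "level_char n (inv\<^bsub>G\<^esub> g) = inv (level_char n g)" if "g \<in> carrier G" for n g
    using group_hom.hom_inv[OF level_char_hom] that .
  have sub: "subgroup N G"
    by (rule G.subgroupI)
      (auto simp: N_def level_char_mult inv level_char_one intro!: exI[of _ "\<one>\<^bsub>G\<^esub>"])
  have "N \<lhd> G"
    unfolding G.normal_inv_iff
    by (intro conjI sub) (auto simp: N_def level_char_mult inv level_char_closed)
  moreover have "closedin (wreath_topology d P) N"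
  proof -
    have "openin (wreath_topology d P) (carrier G - N)"
      unfolding openin_wreath_topology
    proof (intro conjI ballI)
      fix g assume g: "g \<in> carrier G - N"
      then obtain n where n: "level_char n g \<noteq> \<one>" by (auto simp: N_def)
      have "h \<in> carrier G - N" if "h \<in> carrier G" "agree d (Suc n) g h" for h
        using that n level_char_agree[of g h n] g by (auto simp: N_def)
      thus "\<exists>n. \<forall>h\<in>carrier G. agree d n g h \<longrightarrow> h \<in> carrier G - N" by blast
    qed auto
    thus ?thesis using subgroup.subset[OF sub]
      unfolding closedin_def topspace_wreath_topology by (simp add: carrier_G)
  qed
  moreover have "N \<noteq> {\<one>\<^bsub>G\<^esub>}"
  proof -
    \<comment> \<open>The same label below two letters, once inverted: the contributions cancel in
      every character.\<close>
    let ?z = "below 1 (rooted p0) \<otimes>\<^bsub>G\<^esub> inv\<^bsub>G\<^esub> (below 2 (rooted p0))"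
    have d12: "1 \<in> {1..d}" "2 \<in> {1..d}" using d2 by auto
    have lc: "level_char n (below 1 (rooted p0)) = level_char n (below 2 (rooted p0))" for n
      by (cases n) (simp_all only: level_char_0_below level_char_Suc_below d12 rooted_closed p0)
    have "?z \<in> N"
      using lc p0 by (auto simp: N_def level_char_mult inv level_char_closed)
    moreover have "?z \<noteq> \<one>\<^bsub>G\<^esub>"
    proof
      assume "?z = \<one>\<^bsub>G\<^esub>"
      hence "below 1 (rooted p0) = below 2 (rooted p0)"
        using p0 G.inv_solve_right[of "\<one>\<^bsub>G\<^esub>" "below 1 (rooted p0)" "below 2 (rooted p0)"] by simp
      hence "sec d (below 1 (rooted p0)) 1 = sec d (below 2 (rooted p0)) 1" by metis
      moreover have "sec d (below 1 (rooted p0)) 1 = rooted p0"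
        unfolding below_def by (subst sec_node[of _ 1]) (use d12 p0 in auto)
      moreover have "sec d (below 2 (rooted p0)) 1 = id"
        unfolding below_def by (subst sec_node[of _ 1]) (use d12 p0 in auto)
      ultimately have "level_char 0 (rooted p0) = level_char 0 \<one>\<^bsub>G\<^esub>" by (metis one_G)
      thus False using level_char_rooted[OF p0, of 0] level_char_one[of 0] \<theta>_p0 by simp
    qed
    ultimately show ?thesis by blast
  qed
  ultimately have fin: "finite (rcosets\<^bsub>G\<^esub> N)" using J unfolding just_infinite_def by blast
  have "inj (\<lambda>n. N #>\<^bsub>G\<^esub> marker n)"
  proof (rule injI)
    fix m n assume "N #>\<^bsub>G\<^esub> marker m = N #>\<^bsub>G\<^esub> marker n"
    hence "marker m \<otimes>\<^bsub>G\<^esub> inv\<^bsub>G\<^esub> (marker n) \<in> N"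
      using G.coset_eq_iff[OF sub marker_closed marker_closed] by simp
    hence "level_char m (marker m \<otimes>\<^bsub>G\<^esub> inv\<^bsub>G\<^esub> (marker n)) = \<one>" by (simp add: N_def)
    hence "level_char m (marker m) \<otimes> inv (level_char m (marker n)) = \<one>"
      by (simp add: level_char_mult marker_closed inv)
    thus "m = n" using \<theta>_p0 \<theta>_closed[OF p0] by (auto simp: level_char_marker split: if_splits)
  qed
  moreover have "range (\<lambda>n. N #>\<^bsub>G\<^esub> marker n) \<subseteq> rcosets\<^bsub>G\<^esub> N"
    using G.rcosetsI[OF subgroup.subset[OF sub] marker_closed] by blast
  ultimately show False using fin by (meson finite_imageD finite_subset infinite_UNIV_nat)
qed

text \<open>A continuous homomorphism is determined by its values on topological generators, so there are
  only finitely many into \<open>A\<close>; but the level characters are pairwise distinct.\<close>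

lemma not_topologically_finitely_generated:
  "\<not> topologically_finitely_generated G (wreath_topology d P)"
proof
  assume "topologically_finitely_generated G (wreath_topology d P)"
  then obtain S where S: "finite S" "S \<subseteq> carrier G"
    and dense: "(wreath_topology d P) closure_of (generate G S) = carrier G"
    unfolding topologically_finitely_generated_def topspace_wreath_topology carrier_G by blast
  let ?F = "\<lambda>n. restrict (level_char n) S"
  have "range ?F \<subseteq> S \<rightarrow>\<^sub>E carrier A"
    using S level_char_closed by (auto simp: restrict_PiE_iff)
  hence "finite (range ?F)" using S finite_A finite_PiE finite_subset by metis
  hence "\<not> inj ?F" using finite_imageD infinite_UNIV_nat by blast
  then obtain m n where mn: "m \<noteq> n" "?F m = ?F n" unfolding inj_def by blast
  have eqS: "level_char m s = level_char n s" if "s \<in> S" for s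
    using fun_cong[OF mn(2), of s] that by simp
  have gen: "g \<in> carrier G" if "g \<in> generate G S" for g
    using G.generate_in_carrier[OF S(2) that] .
  have eq: "level_char m g = level_char n g" if "g \<in> generate G S" for g
    using that
  proof (induction rule: generate.induct)
    case one
    show ?case by (simp only: level_char_one)
  next
    case (incl h)
    thus ?case by (rule eqS)
  next
    case (inv h)
    thus ?case using eqS group_hom.hom_inv[OF level_char_hom] S by (metis subsetD)
  next
    case (eng h1 h2)
    thus ?case using gen by (simp add: level_char_mult)
  qed
  \<comment> \<open>Agreement on this level determines both characters \<open>m\<close> and
    \<open>n\<close>, so their equality on the generated subgroup transfers to
    \<open>marker m\<close>.\<close>
  let ?U = "{h \<in> carrier G. agree d (Suc (max m n)) (marker m) h}"
  have U: "marker m \<in> ?U \<and> openin (wreath_topology d P) ?U"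
    unfolding openin_wreath_topology using agree_trans marker_closed agree_refl by blast
  have "marker m \<in> (wreath_topology d P) closure_of (generate G S)"
    using dense marker_closed by metis
  from this[unfolded in_closure_of, THEN conjunct2, rule_format, OF U]
  obtain h where h: "h \<in> generate G S" "agree d (Suc (max m n)) (marker m) h" by blast
  have "level_char k (marker m) = level_char k h" if "k \<le> max m n" for k
    using that h gen agree_mono[OF marker_closed _ h(2)] by (intro level_char_agree marker_closed) auto
  hence "level_char m (marker m) = level_char n (marker m)" using eq[OF h(1)] by simp
  thus False using mn(1) \<theta>_p0 by (simp add: level_char_marker)
qed

text \<open>An accumulation point of the level characters is a discontinuous homomorphism into \<open>A\<close>.\<close>

lemma not_strongly_complete: "\<not> strongly_complete G (wreath_topology d P)"
proof
  assume sc: "strongly_complete G (wreath_topology d P)"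
  have "\<exists>\<psi>. \<forall>E N. finite E \<and> E \<subseteq> carrier G \<longrightarrow> (\<exists>n\<ge>N. \<forall>g\<in>E. level_char n g = \<psi> g)"
    by (rule pointwise_accumulation[where A = "\<lambda>_. carrier A"]) (simp_all add: finite_A level_char_closed)
  then obtain \<psi> where
    \<psi>: "\<forall>E N. finite E \<and> E \<subseteq> carrier G \<longrightarrow> (\<exists>n\<ge>N. \<forall>g\<in>E. level_char n g = \<psi> g)" ..
  \<comment> \<open>Multiplicativity concerns three elements at a time, so it passes to \<psi> from
    any character that coincides with \<psi> on these three.\<close>
  have ex: "\<exists>n\<ge>N. level_char n g = \<psi> g \<and> level_char n h = \<psi> h \<and>
      level_char n (g \<otimes>\<^bsub>G\<^esub> h) = \<psi> (g \<otimes>\<^bsub>G\<^esub> h)"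
    if "g \<in> carrier G" "h \<in> carrier G" for g h N
    using \<psi>[rule_format, of "{g, h, g \<otimes>\<^bsub>G\<^esub> h}" N] that by auto
  have "\<psi> \<in> hom G A"
  proof (rule homI)
    fix g h assume g: "g \<in> carrier G" and h: "h \<in> carrier G"
    obtain n where n: "level_char n g = \<psi> g" "level_char n h = \<psi> h"
      "level_char n (g \<otimes>\<^bsub>G\<^esub> h) = \<psi> (g \<otimes>\<^bsub>G\<^esub> h)" using ex[OF g h, of 0] by blast
    show "\<psi> g \<in> carrier A" using n(1) level_char_closed[OF g] by metis
    show "\<psi> (g \<otimes>\<^bsub>G\<^esub> h) = \<psi> g \<otimes> \<psi> h" using n level_char_mult[OF g h] by metis
  qed
  then interpret h: group_hom G A \<psi> by unfold_locales
  let ?K = "kernel G A \<psi>"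
  have sub: "subgroup ?K G" by (rule h.subgroup_kernel)
  have "finite (rcosets\<^bsub>G\<^esub> ?K)"
  proof (rule G.finite_rcosets_if_finite_invariant[OF sub])
    show "finite (\<psi> ` carrier G)" using finite_A by (rule finite_subset[rotated]) auto
  qed (auto simp: kernel_def)
  hence "openin (wreath_topology d P) ?K" using sc sub unfolding strongly_complete_def by blast
  moreover have "\<one>\<^bsub>G\<^esub> \<in> ?K" using subgroup.one_closed[OF sub] .
  ultimately obtain n where n: "\<And>h. h \<in> carrier G \<Longrightarrow> agree d n \<one>\<^bsub>G\<^esub> h \<Longrightarrow> h \<in> ?K"
    unfolding openin_wreath_topology by blast
  \<comment> \<open>This element has the label \<open>p0\<close> all along the ray of letters 1, so
    each of its characters equals \<open>\<theta> p0\<close>. A marker would not do: only one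
    character sees it, so \<psi> does not.\<close>
  have "\<exists>s\<in>carrier G. s = node d p0 (\<lambda>z. if z = 1 then s else id)"
    by (rule directed_element) (simp_all add: p0)
  then obtain s where s: "s \<in> carrier G" "s = node d p0 (\<lambda>z. if z = 1 then s else id)" by blast
  have s': "s = below (p0 1) s \<otimes>\<^bsub>G\<^esub> rooted p0"
  proof -
    have "rooted p0 \<otimes>\<^bsub>G\<^esub> below 1 s = node d p0 (\<lambda>z. if z = 1 then s else id)"
      unfolding rooted_def below_def by (subst node_mult) (auto simp: s(1) mult_G intro!: node_cong)
    thus ?thesis using s rooted_below[OF p0 s(1), of 1] by metis
  qed
  have lc: "level_char m s = \<theta> p0" for m
  proof (induction m)
    case 0
    show ?case by (subst s(2)) (rule level_char_0_node[OF p0])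
  next
    case (Suc m)
    have "p0 1 \<in> {1..d}" using P_mem[OF p0] d2 by simp
    thus ?case using Suc s(1) p0 \<theta>_closed[OF p0]
      by (subst s') (simp add: level_char_mult level_char_Suc_below level_char_rooted del: level_char.simps)
  qed
  \<comment> \<open>Pushed down to level \<open>n\<close>, the element is trivial on that level,
    while its characters from index \<open>n\<close> on are still
    \<open>\<theta> p0\<close>.\<close>
  let ?w = "below_vertex (leftmost n) s"
  have w: "?w \<in> carrier G" using s by simp
  have "agree d n \<one>\<^bsub>G\<^esub> (below_vertex v a)" if "length v = n" "a \<in> carrier G" for v a
    using that
  proof (induction v arbitrary: n)
    case Nil
    thus ?case using agree_0 by simp
  next
    case (Cons x v)
    then obtain m where m: "n = Suc m" by auto
    have "agree d m \<one>\<^bsub>G\<^esub> (below_vertex v a)" using Cons m by simp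
    thus ?case unfolding m below_vertex.simps below_def node_one[symmetric]
      by (subst agree_Suc_node) (auto simp: one_G node_one)
  qed
  hence "?w \<in> ?K" using n[OF w] s leftmost by blast
  hence "\<psi> ?w = \<one>" by (simp add: kernel_def)
  moreover obtain m where "m \<ge> n" "level_char m ?w = \<psi> ?w" using ex[OF w w, of n] by blast
  ultimately have "\<one> = \<theta> p0"
    using level_char_below_vertex[OF s(1) leftmost(1)] leftmost(2) lc by simp
  thus False using \<theta>_p0 by simp
qed

end

section \<open>The dichotomy and the full automorphism group\<close>

context wreath
begin

lemma derived_subset: "derived (sym_group d) P \<subseteq> P"
  using group.derived_incl[OF sym_group_is_group _ P, of P] by simp

lemma imperfect_fails:
  assumes np: "P \<noteq> derived (sym_group d) P"
  shows "\<not> just_infinite G (wreath_topology d P)"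
    "\<not> topologically_finitely_generated G (wreath_topology d P)"
    "\<not> strongly_complete G (wreath_topology d P)"
proof -
  let ?S = "sym_group d\<lparr>carrier := P\<rparr>"
  interpret S: group ?S using group.subgroup_imp_group[OF sym_group_is_group P] .
  \<comment> \<open>Taken inside \<open>?S\<close>, where the quotient is formed; it coincides with
    the derived subgroup computed in the symmetric group.\<close>
  define D where "D = derived ?S P"
  have D: "D = derived (sym_group d) P"
    unfolding D_def by (rule group.derived_consistent[OF sym_group_is_group _ P]) simp
  interpret D: normal D ?S
    using S.derived_is_normal[OF S.normal_self] unfolding D_def by simp
  obtain p0 where p0: "p0 \<in> P" "p0 \<notin> D" using np D derived_subset by blast
  have "comm_group (?S Mod D)" using S.derived_quot_is_comm_group unfolding D_def by simp
  then interpret A: comm_group "?S Mod D" .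
  have "wreath_character d P (?S Mod D) (\<lambda>p. D #>\<^bsub>?S\<^esub> p) p0"
  proof (unfold_locales)
    have "carrier (?S Mod D) \<subseteq> Pow P"
      using S.rcosets_subset_PowG[OF D.subgroup_axioms] by (simp add: FactGroup_def)
    thus "finite (carrier (?S Mod D))" using finite_P finite_subset by blast
    show "D #>\<^bsub>?S\<^esub> p \<in> carrier (?S Mod D)" if "p \<in> P" for p
      using that by (auto simp: FactGroup_def RCOSETS_def)
    show "D #>\<^bsub>?S\<^esub> (p \<circ> q) = (D #>\<^bsub>?S\<^esub> p) \<otimes>\<^bsub>?S Mod D\<^esub> (D #>\<^bsub>?S\<^esub> q)"
      if "p \<in> P" "q \<in> P" for p q
      using D.rcos_sum[of p q] that by (simp add: FactGroup_def sym_group_mult)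
    show "D #>\<^bsub>?S\<^esub> p0 \<noteq> \<one>\<^bsub>?S Mod D\<^esub>"
      using S.coset_join1[of D p0] D.subgroup_axioms p0 by (auto simp: FactGroup_def)
  qed (fact p0)
  then interpret wreath_character d P "?S Mod D" "\<lambda>p. D #>\<^bsub>?S\<^esub> p" p0 .
  show "\<not> just_infinite G (wreath_topology d P)"
    "\<not> topologically_finitely_generated G (wreath_topology d P)"
    "\<not> strongly_complete G (wreath_topology d P)"
    by (rule not_just_infinite not_topologically_finitely_generated not_strongly_complete)+
qed

lemma perfect_holds:
  assumes "P = derived (sym_group d) P"
  shows "just_infinite G (wreath_topology d P)"
    "topologically_finitely_generated G (wreath_topology d P)"
    "strongly_complete G (wreath_topology d P)"
proof -
  interpret perfect_wreath d P by unfold_locales (rule assms[symmetric])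
  show "just_infinite G (wreath_topology d P)"
    "topologically_finitely_generated G (wreath_topology d P)"
    "strongly_complete G (wreath_topology d P)"
    by (rule perfect_just_infinite perfect_topologically_finitely_generated perfect_strongly_complete)+
qed

end

text \<open>The sign is onto for \<open>d \<ge> 2\<close>, but trivial on a perfect group.\<close>

lemma sym_group_not_perfect:
  assumes "d \<ge> 2"
  shows "carrier (sym_group d) \<noteq> derived (sym_group d) (carrier (sym_group d))"
proof
  assume perf: "carrier (sym_group d) = derived (sym_group d) (carrier (sym_group d))"
  hence "sign ` carrier (sym_group d) \<subseteq> {1}" using sign_of_perfect[of "carrier (sym_group d)" d] by auto
  thus False using sign_is_surj[OF assms] by (simp add: sign_img_def)
qed

lemma transitive_sym_group: "transitive_perms d (carrier (sym_group d))"
  unfolding transitive_perms_def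
proof (intro ballI)
  fix x y assume "x \<in> {1..d}" "y \<in> {1..d}"
  thus "\<exists>p\<in>carrier (sym_group d). p x = y"
    by (intro bexI[of _ "Transposition.transpose x y"])
      (simp_all add: sym_group_carrier permutes_swap_id)
qed

theorem corollary3:
  fixes d :: nat
  assumes "d \<ge> 2"
  shows "(\<forall>P. subgroup P (sym_group d) \<and> transitive_perms d P \<longrightarrow>
      (just_infinite (wreath_group d P) (wreath_topology d P)
         \<longleftrightarrow> topologically_finitely_generated (wreath_group d P) (wreath_topology d P)) \<and>
      (topologically_finitely_generated (wreath_group d P) (wreath_topology d P)
         \<longleftrightarrow> strongly_complete (wreath_group d P) (wreath_topology d P)) \<and>
      (strongly_complete (wreath_group d P) (wreath_topology d P)
         \<longleftrightarrow> P = derived (sym_group d) P))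
    \<and> \<not> just_infinite (tree_aut d) (tree_aut_topology d)
    \<and> \<not> topologically_finitely_generated (tree_aut d) (tree_aut_topology d)
    \<and> \<not> strongly_complete (tree_aut d) (tree_aut_topology d)"
proof -
  \<comment> \<open>All three properties hold or all three fail, according to whether
    \<open>P\<close> is perfect; the equivalences are then propositional.\<close>
  have main: "(if P = derived (sym_group d) P
      then just_infinite (wreath_group d P) (wreath_topology d P) \<and>
        topologically_finitely_generated (wreath_group d P) (wreath_topology d P) \<and>
        strongly_complete (wreath_group d P) (wreath_topology d P)
      else \<not> just_infinite (wreath_group d P) (wreath_topology d P) \<and>
        \<not> topologically_finitely_generated (wreath_group d P) (wreath_topology d P) \<and>
        \<not> strongly_complete (wreath_group d P) (wreath_topology d P))"
    if "subgroup P (sym_group d)" "transitive_perms d P" for P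
  proof -
    interpret wreath d P by (rule wreath.intro) (fact assms that)+
    show ?thesis using imperfect_fails perfect_holds unfolding G_def by auto
  qed
  \<comment> \<open>Aut(T) is the case where \<open>P\<close> is the whole symmetric group, which is
    transitive and not perfect.\<close>
  let ?C = "carrier (sym_group d)"
  have grp: "wreath_group d ?C = tree_aut d" by (simp add: iterated_wreath_full)
  have "wreath_topology d ?C = tree_aut_topology d"
    unfolding iterated_wreath_full by (metis subtopology_topspace topspace_tree_aut_topology)
  hence "\<not> just_infinite (tree_aut d) (tree_aut_topology d) \<and>
    \<not> topologically_finitely_generated (tree_aut d) (tree_aut_topology d) \<and>
    \<not> strongly_complete (tree_aut d) (tree_aut_topology d)"
    using main[OF group.subgroup_self[OF sym_group_is_group] transitive_sym_group]
      sym_group_not_perfect[OF assms] grp by simp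
  moreover have "(just_infinite (wreath_group d P) (wreath_topology d P)
         \<longleftrightarrow> topologically_finitely_generated (wreath_group d P) (wreath_topology d P)) \<and>
      (topologically_finitely_generated (wreath_group d P) (wreath_topology d P)
         \<longleftrightarrow> strongly_complete (wreath_group d P) (wreath_topology d P)) \<and>
      (strongly_complete (wreath_group d P) (wreath_topology d P)
         \<longleftrightarrow> P = derived (sym_group d) P)"
    if "subgroup P (sym_group d)" "transitive_perms d P" for P
    using main[OF that] by argo
  ultimately show ?thesis by blast
qed

end
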